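(* Let $X$ be a complex Banach space and let $A\subseteq B(X)$ be an abelian, unital, semisimple, strongly closed subalgebra with split strict multiplicity $s.s.m.(A)=p\in\mathbb{N}$, realized by vectors $x_1,\dots,x_p\in X$. For $j=1,\dots,p$ let $I_j=\{a\in A : ax_j=0\}$, let $\varphi_j:A\to A/I_j$ be the quotient map, let $\mathcal{R}_j$ be the radical of $A/I_j$, and let $S:\bigoplus_{j=1}^p A/I_j\to X$ be the Banach space isomorphism $S(\varphi_1(a_1)\oplus\cdots\oplus\varphi_p(a_p))=\sum_{j=1}^p a_jx_j$. Let $L\subseteq A$ be a norm closed subspace. If $T\in B(X)$ is such that $Tx\in\overline{Lx}$ for every $x\in X$, then there exists $l_0\in L$ such that $$(T-l_0)x\in S\Big(\bigoplus_{j=1}^p\mathcal{R}_j\Big)\quad\text{for every }x\in X.$$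
   Context: $B(X)$ is the algebra of bounded linear operators on $X$; "strongly closed" means closed in the strong operator topology; $A$ carries the operator norm. $Lx=\{lx : l\in L\}$ and the closure is in the norm of $X$. An algebra $A\subset B(X)$ has split strict multiplicity $p\in\mathbb{N}$, written $s.s.m.(A)=p$, if there are $x_1,\dots,x_p\in X$ such that the subspaces $X_i=\{ax_i : a\in A\}$ are closed and $X=X_1\oplus\cdots\oplus X_p$ (such vectors are fixed; they "realize" the split strict multiplicity). $A$ is semisimple if the intersection of all its maximal modular ideals is $(0)$ (for unital $A$ these are the maximal ideals). Each $I_j$ is a closed ideal of $A$, and the map $S$ is a well-defined Banach space isomorphism. The radical of the abelian unital Banach algebra $A/I_j$ is the intersection of all its maximal ideals. *)

theory Defs
  imports "HOL-Analysis.Analysis" "HOL-Algebra.QuotRing"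
begin

class complex_normed_vector = real_normed_vector +
  fixes scaleC :: "complex \<Rightarrow> 'a \<Rightarrow> 'a"  (infixr \<open>*\<^sub>C\<close> 75)
  assumes scaleC_add_right: "c *\<^sub>C (x + y) = c *\<^sub>C x + c *\<^sub>C y"
    and scaleC_add_left: "(c + d) *\<^sub>C x = c *\<^sub>C x + d *\<^sub>C x"
    and scaleC_scaleC: "c *\<^sub>C d *\<^sub>C x = (c * d) *\<^sub>C x"
    and scaleC_of_real: "complex_of_real r *\<^sub>C x = r *\<^sub>R x"
    and norm_scaleC: "norm (c *\<^sub>C x) = cmod c * norm x"

class complex_banach = complex_normed_vector + banach

instantiation complex :: complex_banach
begin

definition "c *\<^sub>C (x :: complex) = c * x"

instance
  by standard (auto simp: scaleC_complex_def algebra_simps norm_mult scaleR_conv_of_real)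

end

lemma bounded_linear_scaleC: "bounded_linear (\<lambda>x :: 'a :: complex_normed_vector. c *\<^sub>C x)"
proof (rule bounded_linear_intro[where K = "cmod c"])
  fix r :: real and x :: 'a
  show "c *\<^sub>C (r *\<^sub>R x) = r *\<^sub>R c *\<^sub>C x"
    by (metis scaleC_of_real scaleC_scaleC mult.commute)
qed (auto simp: scaleC_add_right norm_scaleC mult.commute)

text \<open>Real-linear bounded operators into a complex normed space form a complex normed
  space under pointwise scaling and the operator norm.\<close>

instantiation blinfun :: (real_normed_vector, complex_normed_vector) complex_normed_vector
begin

definition "c *\<^sub>C (f :: 'a \<Rightarrow>\<^sub>L 'b) = Blinfun (\<lambda>x. c *\<^sub>C blinfun_apply f x)"

lemma blinfun_apply_scaleC:
  "blinfun_apply (c *\<^sub>C (f :: 'a \<Rightarrow>\<^sub>L 'b)) x = c *\<^sub>C blinfun_apply f x"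
proof -
  have "bounded_linear (\<lambda>x. c *\<^sub>C blinfun_apply f x)"
    using bounded_linear_compose[OF bounded_linear_scaleC blinfun.bounded_linear_right] .
  then show ?thesis
    by (simp add: scaleC_blinfun_def bounded_linear_Blinfun_apply)
qed

instance
proof
  fix c d :: complex and r :: real and f g :: "'a \<Rightarrow>\<^sub>L 'b"
  show "c *\<^sub>C (f + g) = c *\<^sub>C f + c *\<^sub>C g"
    by (rule blinfun_eqI) (simp add: blinfun_apply_scaleC blinfun.add_left scaleC_add_right)
  show "(c + d) *\<^sub>C f = c *\<^sub>C f + d *\<^sub>C f"
    by (rule blinfun_eqI) (simp add: blinfun_apply_scaleC blinfun.add_left scaleC_add_left)
  show "c *\<^sub>C d *\<^sub>C f = (c * d) *\<^sub>C f"
    by (rule blinfun_eqI) (simp add: blinfun_apply_scaleC scaleC_scaleC)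
  show "complex_of_real r *\<^sub>C f = r *\<^sub>R f"
    by (rule blinfun_eqI) (simp add: blinfun_apply_scaleC blinfun.scaleR_left scaleC_of_real)
  have "onorm (\<lambda>x. cmod c *\<^sub>R blinfun_apply f x) = cmod c * onorm (blinfun_apply f)"
    using onorm_scaleR[OF blinfun.bounded_linear_right, of "cmod c" f] by simp
  then show "norm (c *\<^sub>C f) = cmod c * norm f"
    by (simp add: norm_blinfun.rep_eq onorm_def blinfun_apply_scaleC norm_scaleC)
qed

end

instance blinfun :: (real_normed_vector, complex_banach) complex_banach ..

definition csubspace :: "'a :: complex_normed_vector set \<Rightarrow> bool" where
  "csubspace S \<longleftrightarrow>
     0 \<in> S \<and> (\<forall>x\<in>S. \<forall>y\<in>S. x + y \<in> S) \<and> (\<forall>c. \<forall>x\<in>S. c *\<^sub>C x \<in> S)"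

text \<open>The algebra \<open>B(X)\<close>: the type of bounded linear functions is only real-linear.\<close>

definition bounded_ops :: "('a :: complex_normed_vector \<Rightarrow>\<^sub>L 'a) set" where
  "bounded_ops =
     {T. \<forall>c x. blinfun_apply T (c *\<^sub>C x) = c *\<^sub>C blinfun_apply T x}"

definition unital_subalgebra :: "('a :: complex_normed_vector \<Rightarrow>\<^sub>L 'a) set \<Rightarrow> bool" where
  "unital_subalgebra A \<longleftrightarrow>
     A \<subseteq> bounded_ops \<and> csubspace A \<and> id_blinfun \<in> A \<and> (\<forall>a\<in>A. \<forall>b\<in>A. a o\<^sub>L b \<in> A)"

definition abelian :: "('a :: complex_normed_vector \<Rightarrow>\<^sub>L 'a) set \<Rightarrow> bool" where
  "abelian A \<longleftrightarrow> (\<forall>a\<in>A. \<forall>b\<in>A. a o\<^sub>L b = b o\<^sub>L a)"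

definition orbit_of :: "('a :: complex_normed_vector \<Rightarrow>\<^sub>L 'a) set \<Rightarrow> 'a \<Rightarrow> 'a set" where
  "orbit_of L x = (\<lambda>l. blinfun_apply l x) ` L"

definition realizes_ssm ::
    "('a :: complex_normed_vector \<Rightarrow>\<^sub>L 'a) set \<Rightarrow> nat \<Rightarrow> (nat \<Rightarrow> 'a) \<Rightarrow> bool" where
  "realizes_ssm A p x \<longleftrightarrow>
     (\<forall>i\<in>{1..p}. closed (orbit_of A (x i))) \<and>
     (\<forall>y. \<exists>!u. u \<in> (\<Pi>\<^sub>E i\<in>{1..p}. orbit_of A (x i)) \<and> y = (\<Sum>i=1..p. u i))"

definition op_ring :: "('a :: complex_normed_vector \<Rightarrow>\<^sub>L 'a) set \<Rightarrow> ('a \<Rightarrow>\<^sub>L 'a) ring" where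
  "op_ring A = \<lparr>carrier = A, mult = (o\<^sub>L), one = id_blinfun, zero = 0, add = (+)\<rparr>"

text \<open>In a unital complex algebra every ring ideal is a complex subspace, being closed under
  multiplication by the scalar multiples of the identity; so the maximal algebra ideals are
  exactly the maximal ring ideals. The carrier is intersected explicitly so that the zero ring,
  which has no maximal ideals, is its own radical.\<close>

definition radical_of :: "('b, 'c) ring_scheme \<Rightarrow> 'b set" where
  "radical_of R = carrier R \<inter> \<Inter> {M. maximalideal M R}"

definition semisimple :: "('a :: complex_normed_vector \<Rightarrow>\<^sub>L 'a) set \<Rightarrow> bool" where
  "semisimple A \<longleftrightarrow> radical_of (op_ring A) = {0}"

definition annihilator ::
    "('a :: complex_normed_vector \<Rightarrow>\<^sub>L 'a) set \<Rightarrow> 'a \<Rightarrow> ('a \<Rightarrow>\<^sub>L 'a) set" where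
  "annihilator A x = {a \<in> A. blinfun_apply a x = 0}"

definition quot_alg ::
    "('a :: complex_normed_vector \<Rightarrow>\<^sub>L 'a) set \<Rightarrow> 'a \<Rightarrow> ('a \<Rightarrow>\<^sub>L 'a) set ring" where
  "quot_alg A x = op_ring A Quot annihilator A x"

definition quot_map ::
    "('a :: complex_normed_vector \<Rightarrow>\<^sub>L 'a) set \<Rightarrow> 'a \<Rightarrow> ('a \<Rightarrow>\<^sub>L 'a) \<Rightarrow> ('a \<Rightarrow>\<^sub>L 'a) set" where
  "quot_map A x a = annihilator A x +>\<^bsub>op_ring A\<^esub> a"

text \<open>The map \<open>S\<close>. An element of the direct sum of the quotients \<open>A / I\<^sub>j\<close> is a family of cosets
  in the extensional product over \<open>{1..p}\<close>. The value does not depend on the representatives,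
  by \<open>split_map_quot_map\<close> below.\<close>

definition split_map ::
    "('a :: complex_normed_vector \<Rightarrow>\<^sub>L 'a) set \<Rightarrow> nat \<Rightarrow> (nat \<Rightarrow> 'a)
      \<Rightarrow> (nat \<Rightarrow> ('a \<Rightarrow>\<^sub>L 'a) set) \<Rightarrow> 'a" where
  "split_map A p x \<xi> =
     (THE y. \<exists>a. (\<forall>j\<in>{1..p}. a j \<in> A \<and> \<xi> j = quot_map A (x j) (a j)) \<and>
                 y = (\<Sum>j=1..p. blinfun_apply (a j) (x j)))"

lemma cring_op_ring:
  assumes "unital_subalgebra A" "abelian A"
  shows "cring (op_ring A)"
proof (rule cringI)
  have neg: "- a \<in> A" if "a \<in> A" for a
  proof -
    have "(- 1) *\<^sub>C a = - a"
      using scaleC_of_real[of "- 1" a] by simp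
    then show ?thesis
      using assms(1) that unfolding unital_subalgebra_def csubspace_def by metis
  qed
  show "abelian_group (op_ring A)"
    using assms(1) neg
    by (intro abelian_groupI)
      (auto simp: op_ring_def unital_subalgebra_def csubspace_def intro!: bexI[where x = "- _"])
  show "Group.comm_monoid (op_ring A)"
    using assms
    by (intro comm_monoidI)
      (auto simp: op_ring_def unital_subalgebra_def abelian_def blinfun_eqI)
qed (auto simp: op_ring_def intro!: blinfun_eqI simp: blinfun.add_left)

lemma ideal_annihilator:
  assumes "unital_subalgebra A" "abelian A"
  shows "ideal (annihilator A x) (op_ring A)"
proof -
  interpret cring "op_ring A"
    by (rule cring_op_ring[OF assms])
  have eq: "blinfun_apply (a o\<^sub>L b) x = 0" if "a \<in> annihilator A x" "b \<in> A" for a b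
    using that assms(2) unfolding abelian_def annihilator_def
    by (metis (mono_tags, lifting) blinfun.zero_right blinfun_apply_blinfun_compose mem_Collect_eq)
  have inv: "inv\<^bsub>add_monoid (op_ring A)\<^esub> a \<in> annihilator A x" if a: "a \<in> annihilator A x" for a
  proof -
    have aA: "a \<in> carrier (op_ring A)"
      using a by (simp add: annihilator_def op_ring_def)
    have "\<ominus>\<^bsub>op_ring A\<^esub> a \<in> A" "\<ominus>\<^bsub>op_ring A\<^esub> a + a = 0"
      using a_inv_closed[OF aA] l_neg[OF aA] by (simp_all add: op_ring_def)
    then have "\<ominus>\<^bsub>op_ring A\<^esub> a \<in> annihilator A x"
      using a by (simp add: annihilator_def add_eq_0_iff2 blinfun.minus_left)
    then show ?thesis
      by (simp add: a_inv_def)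
  qed
  show ?thesis
  proof (rule idealI)
    show "ring (op_ring A)"
      by (rule ring_axioms)
    show "subgroup (annihilator A x) (add_monoid (op_ring A))"
      using assms(1) inv
      by unfold_locales
        (auto simp: annihilator_def op_ring_def unital_subalgebra_def csubspace_def blinfun.add_left)
  qed (use eq assms(1) in \<open>auto simp: annihilator_def op_ring_def
         unital_subalgebra_def\<close>)
qed

lemma carrier_quot_alg: "carrier (quot_alg A x) = quot_map A x ` A"
  by (auto simp: quot_alg_def quot_map_def FactRing_def A_RCOSETS_def RCOSETS_def a_r_coset_def
      op_ring_def)

lemma quot_map_eqD:
  assumes "unital_subalgebra A" "quot_map A x a = quot_map A x b"
  shows "blinfun_apply a x = blinfun_apply b x"
proof -
  have "0 \<in> annihilator A x"
    using assms(1) by (auto simp: annihilator_def unital_subalgebra_def csubspace_def)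
  then have "a \<in> quot_map A x a"
    by (force simp: quot_map_def a_r_coset_def r_coset_def op_ring_def)
  then have "a \<in> quot_map A x b"
    using assms(2) by simp
  then obtain h where "h \<in> annihilator A x" "a = h + b"
    by (auto simp: quot_map_def a_r_coset_def r_coset_def op_ring_def)
  then show ?thesis
    by (simp add: annihilator_def blinfun.add_left)
qed

lemma split_map_quot_map:
  assumes "unital_subalgebra A" "\<And>j. j \<in> {1..p} \<Longrightarrow> a j \<in> A"
  shows "split_map A p x (\<lambda>j\<in>{1..p}. quot_map A (x j) (a j)) =
    (\<Sum>j=1..p. blinfun_apply (a j) (x j))"
  unfolding split_map_def
proof (rule the_equality)
  show "\<exists>b. (\<forall>j\<in>{1..p}. b j \<in> A \<and>
      (\<lambda>j\<in>{1..p}. quot_map A (x j) (a j)) j = quot_map A (x j) (b j)) \<and>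
      (\<Sum>j=1..p. blinfun_apply (a j) (x j)) = (\<Sum>j=1..p. blinfun_apply (b j) (x j))"
    using assms(2) by (intro exI[of _ a]) auto
next
  fix y
  assume "\<exists>b. (\<forall>j\<in>{1..p}. b j \<in> A \<and>
      (\<lambda>j\<in>{1..p}. quot_map A (x j) (a j)) j = quot_map A (x j) (b j)) \<and>
      y = (\<Sum>j=1..p. blinfun_apply (b j) (x j))"
  then obtain b where b: "\<forall>j\<in>{1..p}. quot_map A (x j) (a j) = quot_map A (x j) (b j)"
      and y: "y = (\<Sum>j=1..p. blinfun_apply (b j) (x j))"
    by auto
  show "y = (\<Sum>j=1..p. blinfun_apply (a j) (x j))"
    unfolding y using b by (intro sum.cong refl) (metis quot_map_eqD[OF assms(1)])
qed

end

theory Submission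
  imports Defs "HOL-Complex_Analysis.Cauchy_Integral_Formula" "HOL-Probability.Discrete_Topology"
begin

text \<open>
  Put \<open>u = x\<^sub>1 + \<dots> + x\<^sub>p\<close>. By the open mapping theorem every \<open>y\<close> is \<open>\<Sum>i. c\<^sub>i x\<^sub>i\<close> with \<open>c\<^sub>i \<in> A\<close> and
  \<open>\<parallel>c\<^sub>i\<parallel> \<le> C \<parallel>y\<parallel>\<close>; since \<open>A\<close> is commutative this makes \<open>a \<mapsto> a u\<close> bounded below on \<open>A\<close>. Hence \<open>L u\<close> is
  closed and \<open>T u = l\<^sub>0 u\<close> for some \<open>l\<^sub>0 \<in> L\<close>. The operator \<open>T' = T - l\<^sub>0\<close> kills \<open>u\<close> and preserves every closed
  \<open>A\<close>-submodule of \<open>X\<close>. For a maximal ideal \<open>M \<supseteq> I\<^sub>j\<close> of \<open>A\<close>, the vectors with \<open>j\<close>-th component in \<open>M x\<^sub>j\<close> form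
  a closed submodule \<open>N\<close>, and by Gelfand-Mazur every \<open>y\<close> is congruent modulo \<open>N\<close> to a scalar multiple of
  \<open>u\<close>. So \<open>T' y \<in> N\<close>, and intersecting over \<open>M\<close> puts the \<open>j\<close>-th component of \<open>T' y\<close> in the radical.
\<close>

section \<open>The Hahn-Banach theorem\<close>

definition sublinear :: "('a :: real_vector \<Rightarrow> real) \<Rightarrow> bool" where
  "sublinear f \<longleftrightarrow> (\<forall>x y. f (x + y) \<le> f x + f y) \<and> (\<forall>r\<ge>0. \<forall>x. f (r *\<^sub>R x) = r * f x)"

lemma sublinear_zero: "sublinear f \<Longrightarrow> f 0 = 0"
  unfolding sublinear_def by (metis mult_zero_left order_refl scaleR_zero_left)

lemma sublinear_lower: "sublinear f \<Longrightarrow> - f (- x) \<le> f x"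
  using sublinear_zero[of f] unfolding sublinear_def by (metis add.right_inverse neg_le_iff_le
      diff_ge_0_iff_ge diff_minus_eq_add)

text \<open>The inequality at \<open>inverse r\<close> and \<open>r *\<^sub>R x\<close> is the
  reverse of the one at \<open>r\<close> and \<open>x\<close>.\<close>

lemma le_scaled_imp_eq:
  fixes f :: "'a :: real_vector \<Rightarrow> real"
  assumes "\<And>r x. r > 0 \<Longrightarrow> f (r *\<^sub>R x) \<le> r * f x" and "r > 0"
  shows "f (r *\<^sub>R x) = r * f x"
proof -
  have "f (inverse r *\<^sub>R r *\<^sub>R x) \<le> inverse r * f (r *\<^sub>R x)"
    using assms by (metis positive_imp_inverse_positive)
  then have "r * f x \<le> f (r *\<^sub>R x)"
    using assms(2) by (simp add: field_simps)
  then show ?thesis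
    using assms by (simp add: order_antisym)
qed

text \<open>A common criterion for shifts of a functional, infima of chains and distances to a
  subspace. The index \<open>k\<close> may vary with the vectors, so the individual
  \<open>F i\<close> need not be sublinear.\<close>

lemma sublinear_INF:
  fixes F :: "'i \<Rightarrow> 'a :: real_vector \<Rightarrow> real"
  assumes "I \<noteq> {}"
    and bdd: "\<And>x. bdd_below ((\<lambda>i. F i x) ` I)"
    and add: "\<And>i j x y. i \<in> I \<Longrightarrow> j \<in> I \<Longrightarrow> \<exists>k\<in>I. F k (x + y) \<le> F i x + F j y"
    and scale: "\<And>i r x. i \<in> I \<Longrightarrow> r > 0 \<Longrightarrow> \<exists>k\<in>I. F k (r *\<^sub>R x) \<le> r * F i x"
    and zero: "\<And>i. i \<in> I \<Longrightarrow> F i 0 \<ge> 0" "\<exists>i\<in>I. F i 0 \<le> 0"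
  shows "sublinear (\<lambda>x. INF i\<in>I. F i x)"
proof -
  let ?G = "\<lambda>x. INF i\<in>I. F i x"
  have low: "?G x \<le> F i x" if "i \<in> I" for i x
    using bdd that by (rule cINF_lower)
  have greatest: "c \<le> ?G x" if "\<And>i. i \<in> I \<Longrightarrow> c \<le> F i x" for c x
    using assms(1) that by (rule cINF_greatest)
  have add': "?G (x + y) \<le> ?G x + ?G y" for x y
  proof -
    have *: "?G (x + y) - F i x \<le> F j y" if "i \<in> I" "j \<in> I" for i j
      using add[OF that, of x y] low[of _ "x + y"] by fastforce
    have "?G (x + y) - F i x \<le> ?G y" if "i \<in> I" for i
      using * that by (intro greatest) auto
    then have "?G (x + y) - ?G y \<le> ?G x"
      by (intro greatest) (auto simp: algebra_simps)
    then show ?thesis by simp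
  qed
  have scale': "?G (r *\<^sub>R x) \<le> r * ?G x" if "r > 0" for r x
  proof -
    have "?G (r *\<^sub>R x) / r \<le> ?G x"
    proof (rule greatest)
      fix i assume "i \<in> I"
      then have "?G (r *\<^sub>R x) \<le> r * F i x"
        using scale[OF _ that] low order_trans by meson
      then show "?G (r *\<^sub>R x) / r \<le> F i x"
        using that by (simp add: field_simps)
    qed
    then show ?thesis
      using that by (simp add: field_simps)
  qed
  have zero': "?G 0 = 0"
    using zero low[of _ 0] greatest[of 0 0] by fastforce
  have "?G (r *\<^sub>R x) = r * ?G x" if "r \<ge> 0" for r x
    using le_scaled_imp_eq[of ?G, OF scale'] zero' that by (cases "r = 0") auto
  then show ?thesis
    using add' unfolding sublinear_def by blast
qed

text \<open>Take \<open>g x\<close> to be the infimum of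
  \<open>f (x + t *\<^sub>R y) - t * f y\<close> over \<open>t \<ge> 0\<close>; the values
  \<open>t = 0\<close> and \<open>t = 1\<close> give the two bounds.\<close>

lemma sublinear_shift:
  fixes f :: "'a :: real_vector \<Rightarrow> real"
  assumes f: "sublinear f"
  obtains g where "sublinear g" "\<And>x. g x \<le> f x" "\<And>x. g x \<le> f (x + y) - f y"
proof -
  have f_add: "f (a + b) \<le> f a + f b" for a b
    using f by (simp add: sublinear_def)
  have f_scale: "f (r *\<^sub>R a) = r * f a" if "r \<ge> 0" for r a
    using f that by (simp add: sublinear_def)
  define F where "F t x = f (x + t *\<^sub>R y) - t * f y" for t x
  define g where "g x = (INF t\<in>{0..}. F t x)" for x
  \<comment> \<open>Subadditivity applied to
    \<open>t *\<^sub>R y = - x + (x + t *\<^sub>R y)\<close> gives a lower bound independent of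
    \<open>t\<close>.\<close>
  have bdd: "bdd_below ((\<lambda>t. F t x) ` {0..})" for x
  proof (rule bdd_belowI2)
    fix t :: real assume "t \<in> {0..}"
    then show "- f (- x) \<le> F t x"
      using f_add[of "- x" "x + t *\<^sub>R y"] f_scale[of t y] by (simp add: F_def)
  qed
  have "sublinear g"
    unfolding g_def
  proof (rule sublinear_INF[OF _ bdd])
    fix i j r :: real and a b assume i: "i \<in> {0..}"
    show "\<exists>k\<in>{0..}. F k (a + b) \<le> F i a + F j b" if "j \<in> {0..}"
      using i that f_add[of "a + i *\<^sub>R y" "b + j *\<^sub>R y"]
      by (intro bexI[of _ "i + j"]) (auto simp: F_def algebra_simps)
    show "\<exists>k\<in>{0..}. F k (r *\<^sub>R a) \<le> r * F i a" if "r > 0"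
      using i that f_scale[of r "a + i *\<^sub>R y"]
      by (intro bexI[of _ "r * i"]) (auto simp: F_def algebra_simps)
    show "0 \<le> F i 0"
      using i f_scale[of i y] by (simp add: F_def)
  qed (use sublinear_zero[OF f] in \<open>auto simp: F_def intro!: bexI[of _ 0]\<close>)
  moreover have "g x \<le> F t x" if "t \<ge> 0" for t x
    unfolding g_def using bdd that by (intro cINF_lower) auto
  from this[of 0] this[of 1] have "g x \<le> f x" "g x \<le> f (x + y) - f y" for x
    by (auto simp: F_def)
  ultimately show ?thesis
    using that by blast
qed

text \<open>A minimal sublinear functional is linear, since it is not decreased by any shift.\<close>

lemma sublinear_dominates_linear:
  fixes f :: "'a :: real_vector \<Rightarrow> real"
  assumes f: "sublinear f"
  obtains g where "linear g" "\<And>x. g x \<le> f x"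
proof -
  define A where "A = {g. sublinear g \<and> (\<forall>x. g x \<le> f x)}"
  have "\<exists>m\<in>A. \<forall>a\<in>A. a \<le> m \<longrightarrow> a = m"
  \<comment> \<open>The order is reversed, so the maximal element supplied by Zorn's lemma is a
    minimal functional.\<close>
  proof (rule predicate_Zorn[where P = "\<lambda>x y. y \<le> x"])
    show "partial_order_on A (relation_of (\<lambda>x y. y \<le> x) A)"
      by (auto simp: partial_order_on_def preorder_on_def refl_on_def trans_def antisym_def
          relation_of_def)
  next
    fix C assume "C \<in> Chains (relation_of (\<lambda>x y. y \<le> x) A)"
    then have C: "C \<subseteq> A" and chain: "\<And>g h. g \<in> C \<Longrightarrow> h \<in> C \<Longrightarrow> g \<le> h \<or> h \<le> g"
      by (auto simp: Chains_def relation_of_def)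
    show "\<exists>u\<in>A. \<forall>a\<in>C. u \<le> a"
    \<comment> \<open>The pointwise infimum needs a nonempty chain; the empty one is bounded by
      \<open>f\<close> itself.\<close>
    proof (cases "C = {}")
      case True
      then show ?thesis using f by (auto simp: A_def)
    next
      case False
      let ?u = "\<lambda>x. INF g\<in>C. g x"
      have sub: "sublinear g" "g x \<le> f x" if "g \<in> C" for g x
        using C that by (auto simp: A_def)
      have bdd: "bdd_below ((\<lambda>g. g x) ` C)" for x
      proof (rule bdd_belowI2)
        fix g assume "g \<in> C"
        then show "- f (- x) \<le> g x"
          using sublinear_lower[OF sub(1), of g x] sub(2)[of g "- x"] by simp
      qed
      have "sublinear ?u"
      proof (rule sublinear_INF[OF False bdd])
        fix g h and r :: real and x y assume g: "g \<in> C"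
        show "\<exists>k\<in>C. k (x + y) \<le> g x + h y" if h: "h \<in> C"
        \<comment> \<open>In a chain, the smaller of the two functionals serves for both
          summands.\<close>
        proof (cases "g \<le> h")
          case True
          then have "g (x + y) \<le> g x + h y"
            using sub(1)[OF g] unfolding sublinear_def le_fun_def by (metis add_left_mono order_trans)
          then show ?thesis using g by blast
        next
          case False
          then have "h \<le> g" using chain g h by blast
          then have "h (x + y) \<le> g x + h y"
            using sub(1)[OF h] unfolding sublinear_def le_fun_def by (metis add_right_mono order_trans)
          then show ?thesis using h by blast
        qed
        show "\<exists>k\<in>C. k (r *\<^sub>R x) \<le> r * g x" if "r > 0"
          using sub(1)[OF g] g that by (intro bexI[of _ g]) (auto simp: sublinear_def)
        show "0 \<le> g 0"
          using sublinear_zero[OF sub(1)[OF g]] by simp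
      qed (use False sub(1) sublinear_zero in fastforce)
      moreover have "?u x \<le> g x" if "g \<in> C" for g x
        using bdd that by (rule cINF_lower)
      ultimately show ?thesis
        using False sub(2) by (intro bexI[of _ ?u]) (fastforce simp: A_def le_fun_def intro: order_trans)+
    qed
  qed
  then obtain m where m: "sublinear m" "\<And>x. m x \<le> f x"
      and min: "\<And>g. sublinear g \<Longrightarrow> (\<And>x. g x \<le> m x) \<Longrightarrow> g = m"
    unfolding A_def le_fun_def by simp (meson order_trans)
  have add: "m (x + y) = m x + m y" for x y
  proof -
    obtain g where "sublinear g" "\<And>x. g x \<le> m x" "\<And>x. g x \<le> m (x + y) - m y"
      using sublinear_shift[OF m(1)] by blast
    then have "m x \<le> m (x + y) - m y"
      using min by metis
    then show ?thesis
      using m(1) by (force simp: sublinear_def intro: order_antisym)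
  qed
  have minus: "m (- x) = - m x" for x
    using add[of x "- x"] sublinear_zero[OF m(1)] by simp
  have "m (r *\<^sub>R x) = r * m x" for r x
  proof (cases "r \<ge> 0")
    case False
    then have "m ((- r) *\<^sub>R x) = (- r) * m x"
      using m(1)[unfolded sublinear_def, THEN conjunct2, rule_format, of "- r"] by simp
    then show ?thesis using minus[of "r *\<^sub>R x"] by simp
  qed (use m(1) in \<open>simp add: sublinear_def\<close>)
  then have "linear m"
    using add by (intro linearI) auto
  then show ?thesis
    using m(2) that by blast
qed

text \<open>Approximants in \<open>M\<close> to \<open>x\<close> and \<open>y\<close> can be added
  and scaled without leaving \<open>M\<close>.\<close>

lemma sublinear_infdist:
  fixes M :: "'a :: real_normed_vector set"
  assumes M: "subspace M"
  shows "sublinear (\<lambda>x. infdist x M)"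
proof -
  have ne: "M \<noteq> {}" using subspace_0[OF M] by blast
  have "sublinear (\<lambda>x. INF m\<in>M. dist x m)"
  proof (rule sublinear_INF[OF ne])
    fix i j x y and r :: real assume i: "i \<in> M"
    show "\<exists>k\<in>M. dist (x + y) k \<le> dist x i + dist y j" if "j \<in> M"
      using i that M dist_triangle_add[of x y i j] by (intro bexI[of _ "i + j"]) (auto simp: subspace_add)
    show "\<exists>k\<in>M. dist (r *\<^sub>R x) k \<le> r * dist x i" if "r > 0"
      using i that M by (intro bexI[of _ "r *\<^sub>R i"]) (auto simp: subspace_scale dist_norm simp flip: scaleR_diff_right)
  qed (use subspace_0[OF M] in \<open>auto intro!: bexI[of _ 0] bdd_belowI2[of _ 0]\<close>)
  then show ?thesis
    using ne by (simp add: infdist_def)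
qed

section \<open>Complex functionals vanishing on a subspace\<close>

lemma csubspace_imp_subspace: "csubspace M \<Longrightarrow> subspace M"
  unfolding csubspace_def subspace_def by (metis scaleC_of_real)

lemma scaleC_one [simp]: "1 *\<^sub>C (x :: 'a :: complex_normed_vector) = x"
  using scaleC_of_real[of 1 x] by simp

text \<open>Hahn-Banach: complexification \<open>f x - \<i> f (\<i> x)\<close> of a real functional \<open>f\<close> dominated by the
  distance to \<open>M\<close>. The bound 2 is crude but suffices.\<close>

lemma complex_functional_vanishing_on:
  fixes M :: "'a :: complex_normed_vector set"
  assumes M: "csubspace M" and z: "z \<notin> closure M"
  obtains \<Lambda> :: "'a \<Rightarrow> complex"
  where "\<And>x y. \<Lambda> (x + y) = \<Lambda> x + \<Lambda> y" "\<And>c x. \<Lambda> (c *\<^sub>C x) = c * \<Lambda> x"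
    "\<And>x. cmod (\<Lambda> x) \<le> 2 * norm x" "\<And>m. m \<in> M \<Longrightarrow> \<Lambda> m = 0" "\<Lambda> z \<noteq> 0"
proof -
  have sM: "subspace M" using csubspace_imp_subspace[OF M] .
  have ne: "M \<noteq> {}" using subspace_0[OF sM] by blast
  \<comment> \<open>Shifting along \<open>z\<close> before linearizing forces
    \<open>g (- z) \<le> - infdist z M\<close>, so that the linear minorant \<open>f\<close> is
    positive at \<open>z\<close>.\<close>
  obtain g where g: "sublinear g" "\<And>x. g x \<le> infdist x M"
      "\<And>x. g x \<le> infdist (x + z) M - infdist z M"
    using sublinear_shift[OF sublinear_infdist[OF sM]] by blast
  obtain f where f: "linear f" "\<And>x. f x \<le> g x"
    using sublinear_dominates_linear[OF g(1)] by blast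
  have f_le: "f x \<le> infdist x M" for x
    using f(2) g(2) order_trans by blast
  have inf_norm: "infdist x M \<le> norm x" for x
    using infdist_le[OF subspace_0[OF sM], of x] by simp
  have f_abs: "\<bar>f x\<bar> \<le> norm x" for x
    using f_le[of x] f_le[of "- x"] inf_norm[of x] inf_norm[of "- x"] linear_neg[OF f(1), of x]
    by (simp add: abs_le_iff)
  have f_M: "f m = 0" if "m \<in> M" for m
    using f_le[of m] f_le[of "- m"] that subspace_neg[OF sM that] linear_neg[OF f(1), of m]
    by simp
  have "infdist z M > 0"
    using z ne infdist_nonneg[of z M] in_closure_iff_infdist_zero[OF ne, of z] by linarith
  moreover have "f (- z) \<le> - infdist z M"
    using f(2)[of "- z"] g(3)[of "- z"] subspace_0[OF sM] by simp
  ultimately have f_z: "f z > 0"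
    using linear_neg[OF f(1), of z] by simp
  define \<Lambda> where "\<Lambda> x = Complex (f x) (- f (\<i> *\<^sub>C x))" for x
  show ?thesis
  proof
    show \<Lambda>_add: "\<Lambda> (x + y) = \<Lambda> x + \<Lambda> y" for x y
      by (simp add: \<Lambda>_def scaleC_add_right linear_add[OF f(1)] complex_eq_iff)
    show "\<Lambda> (c *\<^sub>C x) = c * \<Lambda> x" for c x
    proof -
      have c: "c = complex_of_real (Re c) + complex_of_real (Im c) * \<i>"
        by (simp add: complex_eq_iff)
      have 1: "c *\<^sub>C x = Re c *\<^sub>R x + Im c *\<^sub>R \<i> *\<^sub>C x"
        by (subst c) (simp only: scaleC_add_left flip: scaleC_scaleC scaleC_of_real)
      have "\<i> * c = complex_of_real (Re c) * \<i> + complex_of_real (- Im c)"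
        by (simp add: complex_eq_iff)
      then have 2: "\<i> *\<^sub>C c *\<^sub>C x = Re c *\<^sub>R \<i> *\<^sub>C x - Im c *\<^sub>R x"
        by (simp only: scaleC_scaleC) (simp only: scaleC_add_left scaleC_of_real flip: scaleC_scaleC, simp)
      show ?thesis
        unfolding \<Lambda>_def 2
        unfolding 1 linear_add[OF f(1)] linear_diff[OF f(1)] linear_scale[OF f(1)]
        by (simp add: complex_eq_iff)
    qed
    show "cmod (\<Lambda> x) \<le> 2 * norm x" for x
    proof -
      have "cmod (\<Lambda> x) \<le> \<bar>f x\<bar> + \<bar>f (\<i> *\<^sub>C x)\<bar>"
        using cmod_le[of "\<Lambda> x"] by (simp add: \<Lambda>_def)
      also have "\<dots> \<le> norm x + norm (\<i> *\<^sub>C x)"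
        using f_abs by (intro add_mono)
      finally show ?thesis by (simp add: norm_scaleC)
    qed
    show "\<Lambda> m = 0" if "m \<in> M" for m
      using that M f_M by (simp add: \<Lambda>_def csubspace_def complex_eq_iff)
    show "\<Lambda> z \<noteq> 0"
      using f_z by (simp add: \<Lambda>_def complex_eq_iff)
  qed
qed

section \<open>The open mapping theorem\<close>

text \<open>Baire's theorem yields approximate preimages of controlled norm, and iterating on the
  remaining error makes them exact. The domain is a closed subspace \<open>K\<close> given as a set,
  so that tuples over an operator algebra can be used.\<close>

lemma open_mapping_bound:
  fixes f :: "'a :: banach \<Rightarrow> 'b :: banach"
  assumes f: "bounded_linear f" and K: "closed K" "subspace K" and surj: "f ` K = UNIV"
  obtains C where "C \<ge> 0" "\<And>y. \<exists>x\<in>K. f x = y \<and> norm x \<le> C * norm y"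
proof -
  interpret bounded_linear f by (rule f)
  define V where "V n = closure (f ` (K \<inter> cball 0 (real n)))" for n
  have "\<exists>n. interior (V n) \<noteq> {}"
  proof (rule ccontr)
    assume "\<not> ?thesis"
    then have "euclidean interior_of \<Union> (range V) = {}"
      by (intro Baire_category_alt) (auto simp: V_def completely_metrizable_space_euclidean)
    moreover have "\<Union> (range V) = UNIV"
    proof (intro equalityI subsetI UNIV_I)
      fix y :: 'b
      obtain k where k: "k \<in> K" "f k = y" using surj by (metis UNIV_I imageE)
      obtain n where "norm k \<le> real n" using real_arch_simple by blast
      then have "f k \<in> V n"
        unfolding V_def using k(1) closure_subset by fastforce
      then show "y \<in> \<Union> (range V)" using k(2) by blast
    qed
    ultimately show False by simp
  qed
  then obtain n y0 where "y0 \<in> interior (V n)"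
    by blast
  then obtain r where r: "r > 0" "ball y0 r \<subseteq> V n"
    unfolding mem_interior by blast
  have near: "\<exists>k\<in>K. norm k \<le> real n \<and> norm (f k - y) < e"
    if y: "y \<in> ball y0 r" and e: "e > 0" for y e
  proof -
    have "y \<in> closure (f ` (K \<inter> cball 0 (real n)))" using r(2) y by (auto simp: V_def)
    then obtain z where "z \<in> f ` (K \<inter> cball 0 (real n))" "dist z y < e"
      using e unfolding closure_approachable by blast
    then show ?thesis by (auto simp: dist_norm)
  qed
  have half: "\<exists>k\<in>K. norm k \<le> (4 * real n / r) * norm y \<and> norm (y - f k) \<le> norm y / 2" for y
  proof (cases "y = 0")
    case True
    then show ?thesis using subspace_0[OF K(2)] by (intro bexI[of _ 0]) (auto simp: zero)
  next
    case False
    \<comment> \<open>With this scale, \<open>y0 + s *\<^sub>R y\<close> stays in the ball.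
      Subtracting approximate preimages of it and of \<open>y0\<close> cancels the centre; the two
      errors of \<open>r / 8\<close> become at most \<open>norm y / 2\<close> after division by
      \<open>s\<close>.\<close>
    define s where "s = r / (2 * norm y)"
    have s: "s > 0" "s * norm y = r / 2" using False r(1) by (auto simp: s_def)
    have "y0 + s *\<^sub>R y \<in> ball y0 r" "y0 \<in> ball y0 r"
      using s r(1) by (auto simp: dist_norm)
    then obtain k1 k2 where k: "k1 \<in> K" "norm k1 \<le> real n" "norm (f k1 - (y0 + s *\<^sub>R y)) < r / 8"
        "k2 \<in> K" "norm k2 \<le> real n" "norm (f k2 - y0) < r / 8"
      using near r(1) by (metis divide_pos_pos zero_less_numeral)
    define k where "k = (k1 - k2) /\<^sub>R s"
    have "norm (k1 - k2) \<le> 2 * real n"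
      using k norm_triangle_ineq4[of k1 k2] by linarith
    then have "norm k \<le> 2 * real n / s"
      unfolding k_def using s(1) by (simp add: divide_inverse mult.commute mult_left_mono)
    then have "norm k \<le> (4 * real n / r) * norm y"
      using False r(1) by (simp add: s_def)
    moreover have "norm (y - f k) \<le> norm y / 2"
    proof -
      have "y - f k = ((f k2 - y0) - (f k1 - (y0 + s *\<^sub>R y))) /\<^sub>R s"
        using s(1) by (simp add: k_def scaleR diff algebra_simps)
      moreover have "norm ((f k2 - y0) - (f k1 - (y0 + s *\<^sub>R y))) \<le> r / 4"
        using k norm_triangle_ineq4[of "f k2 - y0" "f k1 - (y0 + s *\<^sub>R y)"] by linarith
      ultimately have "norm (y - f k) \<le> (r / 4) / s"
        using s(1) by (simp add: divide_simps mult.commute)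
      also have "\<dots> = norm y / 2"
        using r(1) False by (simp add: s_def field_simps)
      finally show ?thesis .
    qed
    moreover have "k \<in> K"
      using k K(2) by (simp add: k_def subspace_scale subspace_diff)
    ultimately show ?thesis by blast
  qed
  define C where "C = 4 * real n / r"
  have C: "C \<ge> 0" using r(1) by (simp add: C_def)
  obtain h where h: "\<And>y. h y \<in> K" "\<And>y. norm (h y) \<le> C * norm y"
      "\<And>y. norm (y - f (h y)) \<le> norm y / 2"
    using half unfolding C_def by metis
  have "\<exists>x\<in>K. f x = y \<and> norm x \<le> (2 * C) * norm y" for y
  proof -
    \<comment> \<open>\<open>e i\<close> is the error left after \<open>i\<close> corrections. It
      decays geometrically, and the images of the corrections telescope to
      \<open>y - e m\<close>.\<close>
    define e where "e i = ((\<lambda>y. y - f (h y)) ^^ i) y" for i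
    have e_Suc: "e (Suc i) = e i - f (h (e i))" for i by (simp add: e_def)
    have e_norm: "norm (e i) \<le> norm y * (1/2) ^ i" for i
    proof (induction i)
      case (Suc i)
      then show ?case using h(3)[of "e i"] by (simp add: e_Suc)
    qed (simp add: e_def)
    have he: "norm (h (e i)) \<le> (C * norm y) * (1/2) ^ i" for i
      using h(2)[of "e i"] mult_left_mono[OF e_norm C, of i] by (simp add: mult.assoc)
    have geo: "(\<lambda>i. (C * norm y) * (1/2) ^ i) sums (2 * C * norm y)"
      using sums_mult[OF geometric_sums[of "1/2 :: real"], of "C * norm y"] by (simp add: mult.commute mult.left_commute)
    have sh: "summable (\<lambda>i. norm (h (e i)))"
      using he by (intro summable_comparison_test[OF _ sums_summable[OF geo]]) auto
    define k where "k = (\<Sum>i. h (e i))"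
    have k_lim: "(\<lambda>m. \<Sum>i<m. h (e i)) \<longlonglongrightarrow> k"
      unfolding k_def using summable_LIMSEQ[OF summable_norm_cancel[OF sh]] .
    have "k \<in> K"
      by (rule closed_sequentially[OF K(1) _ k_lim]) (intro subspace_sum[OF K(2)] h(1))
    moreover have "norm k \<le> 2 * C * norm y"
    proof -
      have "norm k \<le> (\<Sum>i. norm (h (e i)))"
        unfolding k_def by (rule summable_norm[OF sh])
      also have "\<dots> \<le> (\<Sum>i. (C * norm y) * (1/2) ^ i)"
        by (rule suminf_le[OF he sh sums_summable[OF geo]])
      also have "\<dots> = 2 * C * norm y" using geo by (simp add: sums_iff)
      finally show ?thesis .
    qed
    moreover have "f k = y"
    proof -
      have part: "f (\<Sum>i<m. h (e i)) = y - e m" for m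
        by (induction m) (simp_all add: zero add e_Suc, simp add: e_def)
      have "(\<lambda>m. norm y * (1/2) ^ m) \<longlonglongrightarrow> 0"
        by (intro tendsto_mult_right_zero LIMSEQ_realpow_zero) auto
      then have "e \<longlonglongrightarrow> 0"
        using e_norm by (intro Lim_null_comparison[of e]) auto
      then have "(\<lambda>m. y - e m) \<longlonglongrightarrow> y"
        using tendsto_diff[OF tendsto_const[of y]] by force
      moreover have "(\<lambda>m. f (\<Sum>i<m. h (e i))) \<longlonglongrightarrow> f k"
        using tendsto[OF k_lim] .
      ultimately show ?thesis
        unfolding part by (metis LIMSEQ_unique)
    qed
    ultimately show ?thesis by blast
  qed
  then show ?thesis
    using C that[of "2 * C"] by simp
qed

section \<open>Maximal ideals and the Gelfand-Mazur theorem\<close>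

lemmas compose_bilinear =
  bounded_bilinear.add_left[OF bounded_bilinear_blinfun_compose]
  bounded_bilinear.add_right[OF bounded_bilinear_blinfun_compose]
  bounded_bilinear.diff_left[OF bounded_bilinear_blinfun_compose]
  bounded_bilinear.diff_right[OF bounded_bilinear_blinfun_compose]

lemma scaleC_zero [simp]: "0 *\<^sub>C (x :: 'a :: complex_normed_vector) = 0"
  using scaleC_of_real[of 0 x] by simp

lemma scaleC_minus_left: "(- c) *\<^sub>C x = - (c *\<^sub>C (x :: 'a :: complex_normed_vector))"
  using scaleC_add_left[of c "- c" x] by (simp add: eq_neg_iff_add_eq_0 add.commute)

lemma scaleC_zero_right [simp]: "c *\<^sub>C (0 :: 'a :: complex_normed_vector) = 0"
  using scaleC_add_right[of c 0 "0 :: 'a"] by simp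

lemma scaleC_diff_right: "c *\<^sub>C (x - y) = c *\<^sub>C x - c *\<^sub>C (y :: 'a :: complex_normed_vector)"
  using scaleC_add_right[of c "x - y" y] by simp

lemma scaleC_compose: "(c *\<^sub>C a) o\<^sub>L b = c *\<^sub>C (a o\<^sub>L b)"
  by (rule blinfun_eqI) (simp add: blinfun_apply_scaleC)

lemma blinfun_compose_assoc: "(a o\<^sub>L b) o\<^sub>L c = a o\<^sub>L (b o\<^sub>L c)"
  by (rule blinfun_eqI) simp

lemma compose_id [simp]: "a o\<^sub>L id_blinfun = a" "id_blinfun o\<^sub>L a = a"
  by (rule blinfun_eqI; simp)+

locale commutative_operator_algebra =
  fixes A :: "('a :: complex_banach \<Rightarrow>\<^sub>L 'a) set"
  assumes subalgebra: "unital_subalgebra A" and commutative: "abelian A" and closed: "closed A"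
begin

lemma csubspace_A: "csubspace A" and id_mem: "id_blinfun \<in> A"
  and compose_mem: "a \<in> A \<Longrightarrow> b \<in> A \<Longrightarrow> a o\<^sub>L b \<in> A"
  using subalgebra by (auto simp: unital_subalgebra_def)

lemma subspace_A: "subspace A"
  using csubspace_A by (rule csubspace_imp_subspace)

lemma scaleC_mem: "a \<in> A \<Longrightarrow> c *\<^sub>C a \<in> A"
  using csubspace_A by (simp add: csubspace_def)

lemmas mem_intros = id_mem compose_mem scaleC_mem subspace_add[OF subspace_A]
  subspace_diff[OF subspace_A] subspace_0[OF subspace_A]

lemma commute: "a \<in> A \<Longrightarrow> b \<in> A \<Longrightarrow> a o\<^sub>L b = b o\<^sub>L a"
  using commutative by (simp add: abelian_def)

lemma apply_commute: "a \<in> A \<Longrightarrow> b \<in> A \<Longrightarrow> blinfun_apply a (blinfun_apply b y) = blinfun_apply b (blinfun_apply a y)"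
  using commute by (metis blinfun_apply_blinfun_compose)

lemma apply_scaleC: "a \<in> A \<Longrightarrow> blinfun_apply a (c *\<^sub>C y) = c *\<^sub>C blinfun_apply a y"
  using subalgebra by (auto simp: unital_subalgebra_def bounded_ops_def)

lemma compose_scaleC: "a \<in> A \<Longrightarrow> a o\<^sub>L (c *\<^sub>C b) = c *\<^sub>C (a o\<^sub>L b)"
  by (rule blinfun_eqI) (simp add: blinfun_apply_scaleC apply_scaleC)

text \<open>The map sending \<open>c\<close> to \<open>id_blinfun + (d o\<^sub>L c)\<close>
  contracts the complete set \<open>A\<close> by 1/2; its fixed point inverts
  \<open>id_blinfun - d\<close> and lies in \<open>A\<close>.\<close>

lemma neumann_inverse:
  assumes d: "d \<in> A" "norm d \<le> 1 / 2"
  obtains c where "c \<in> A" "c = id_blinfun + (d o\<^sub>L c)" "norm c \<le> 2"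
proof -
  have "\<exists>!c\<in>A. id_blinfun + (d o\<^sub>L c) = c"
  proof (rule Banach_fix[where c = "1 / 2"])
    show "complete A" using closed by (simp add: complete_eq_closed)
    show "(\<lambda>c. id_blinfun + (d o\<^sub>L c)) ` A \<subseteq> A" using d by (auto intro!: mem_intros)
    show "dist (id_blinfun + (d o\<^sub>L b)) (id_blinfun + (d o\<^sub>L c)) \<le> 1 / 2 * dist b c" for b c
    proof -
      have "norm (d o\<^sub>L (b - c)) \<le> norm d * norm (b - c)" by (rule norm_blinfun_compose)
      also have "\<dots> \<le> 1 / 2 * norm (b - c)" using d(2) by (rule mult_right_mono) simp
      finally show ?thesis by (simp add: dist_norm compose_bilinear)
    qed
  qed (use id_mem in auto)
  then obtain c where c: "c \<in> A" "c = id_blinfun + (d o\<^sub>L c)" by metis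
  have "norm (d o\<^sub>L c) \<le> 1 / 2 * norm c"
    using norm_blinfun_compose[of d c] mult_right_mono[OF d(2), of "norm c"] by simp
  moreover have "norm c \<le> norm (id_blinfun :: 'a \<Rightarrow>\<^sub>L 'a) + norm (d o\<^sub>L c)"
    using c(2) norm_triangle_ineq by metis
  ultimately have "norm c \<le> 2"
    using norm_blinfun_id_le[where 'a='a] by simp
  then show ?thesis using c that by blast
qed

end

text \<open>The last assumption is maximality, phrased as invertibility in the quotient.\<close>

locale maximal_operator_ideal = commutative_operator_algebra A
  for A :: "('a :: complex_banach \<Rightarrow>\<^sub>L 'a) set" +
  fixes M :: "('a \<Rightarrow>\<^sub>L 'a) set"
  assumes subset: "M \<subseteq> A" and csubspace_M: "csubspace M"
    and absorb: "a \<in> A \<Longrightarrow> m \<in> M \<Longrightarrow> a o\<^sub>L m \<in> M"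
    and id_notin: "id_blinfun \<notin> M"
    and inverse_mod: "a \<in> A \<Longrightarrow> a \<notin> M \<Longrightarrow> \<exists>b\<in>A. (b o\<^sub>L a) - id_blinfun \<in> M"
begin

lemma subspace_M: "subspace M"
  using csubspace_M by (rule csubspace_imp_subspace)

text \<open>An element of \<open>M\<close> within 1/2 of the identity would be invertible in
  \<open>A\<close>, which puts the identity in \<open>M\<close>.\<close>

lemma id_notin_closure: "id_blinfun \<notin> closure M"
proof
  assume "id_blinfun \<in> closure M"
  then have "\<exists>m\<in>M. dist m id_blinfun < 1 / 2"
    by (rule closure_approachable[THEN iffD1, rule_format]) simp
  then obtain m where m: "m \<in> M" "dist m id_blinfun < 1 / 2" by blast
  have mA: "m \<in> A" using m subset by blast
  have "id_blinfun - m \<in> A" "norm (id_blinfun - m) \<le> 1 / 2"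
    using m mA by (auto intro: mem_intros simp: dist_norm norm_minus_commute)
  then obtain c where c: "c \<in> A" "c = id_blinfun + ((id_blinfun - m) o\<^sub>L c)"
    using neumann_inverse by blast
  then have "id_blinfun = m o\<^sub>L c" by (simp add: compose_bilinear)
  then show False
    using commute[OF mA c(1)] absorb[OF c(1) m(1)] id_notin by simp
qed

text \<open>If \<open>d\<close> is in the closure but not in \<open>M\<close>, let \<open>b\<close>
  invert \<open>d\<close> modulo \<open>M\<close>, with error \<open>m\<close>. The continuous map
  taking \<open>e\<close> to \<open>(b o\<^sub>L e) - m\<close> preserves \<open>M\<close>, hence
  its closure, and sends \<open>d\<close> to the identity.\<close>

lemma closed_M: "closed M"
proof -
  have "d \<in> M" if d: "d \<in> closure M" for d
  proof (rule ccontr)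
    assume "d \<notin> M"
    have "closure M \<subseteq> A" using subset closed by (rule closure_minimal)
    then obtain b where b: "b \<in> A" "(b o\<^sub>L d) - id_blinfun \<in> M"
      using inverse_mod d \<open>d \<notin> M\<close> by blast
    define m where "m = (b o\<^sub>L d) - id_blinfun"
    have "(\<lambda>e. (b o\<^sub>L e) - m) ` closure M \<subseteq> closure M"
    proof (rule image_closure_subset)
      show "continuous_on (closure M) (\<lambda>e. (b o\<^sub>L e) - m)"
        by (intro continuous_intros)
      show "(\<lambda>e. (b o\<^sub>L e) - m) ` M \<subseteq> closure M"
        using b by (intro image_subsetI subsetD[OF closure_subset] subspace_diff[OF subspace_M] absorb)
          (auto simp: m_def)
    qed simp
    then have "(b o\<^sub>L d) - m \<in> closure M" using d by blast
    then have "id_blinfun \<in> closure M" by (simp add: m_def)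
    then show False using id_notin_closure by simp
  qed
  then show ?thesis by (metis closure_subset closure_closed subsetI subset_antisym closed_closure)
qed

text \<open>The Gelfand-Mazur theorem for \<open>A / M\<close>: if \<open>a\<close> were not a scalar modulo \<open>M\<close>, then
  composing the resolvent of \<open>a\<close> modulo \<open>M\<close> with a functional vanishing on \<open>M\<close> would give a
  nonzero entire function vanishing at infinity.\<close>

theorem scalar_mod:
  assumes a: "a \<in> A"
  shows "\<exists>w. a - w *\<^sub>C id_blinfun \<in> M"
proof (rule ccontr)
  assume no: "\<not> ?thesis"
  define e where "e w = a - w *\<^sub>C id_blinfun" for w
  have eA: "e w \<in> A" for w unfolding e_def using a by (intro mem_intros)
  have "\<exists>b\<in>A. (b o\<^sub>L e w) - id_blinfun \<in> M" for w
    using no inverse_mod eA by (auto simp: e_def)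
  then obtain b where b: "\<And>w. b w \<in> A" "\<And>w. (b w o\<^sub>L e w) - id_blinfun \<in> M" by metis
  obtain \<Lambda> :: "('a \<Rightarrow>\<^sub>L 'a) \<Rightarrow> complex"
    where \<Lambda>_add: "\<And>x y. \<Lambda> (x + y) = \<Lambda> x + \<Lambda> y" and \<Lambda>_scale: "\<And>c x. \<Lambda> (c *\<^sub>C x) = c * \<Lambda> x"
      and \<Lambda>_norm: "\<And>x. cmod (\<Lambda> x) \<le> 2 * norm x" and \<Lambda>_M: "\<And>m. m \<in> M \<Longrightarrow> \<Lambda> m = 0"
      and \<Lambda>_id: "\<Lambda> id_blinfun \<noteq> 0"
    using complex_functional_vanishing_on[OF csubspace_M id_notin_closure] by blast
  define g where "g w = \<Lambda> (b w)" for w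
  \<comment> \<open>The inverses \<open>b w\<close> are arbitrary choices, but two inverses modulo
    \<open>M\<close> differ by an element of \<open>M\<close>. Thus \<open>g w\<close> may be
    computed from any convenient inverse.\<close>
  have g_eq: "g w = \<Lambda> \<beta>" if \<beta>: "\<beta> \<in> A" "(\<beta> o\<^sub>L e w) - id_blinfun \<in> M" for w \<beta>
  proof -
    have "b w - \<beta> = (b w o\<^sub>L (id_blinfun - (\<beta> o\<^sub>L e w))) + (\<beta> o\<^sub>L ((b w o\<^sub>L e w) - id_blinfun))"
      by (rule blinfun_eqI) (simp add: blinfun.bilinear_simps apply_commute[OF b(1) \<beta>(1)])
    also have "\<dots> = (\<beta> o\<^sub>L ((b w o\<^sub>L e w) - id_blinfun)) - (b w o\<^sub>L ((\<beta> o\<^sub>L e w) - id_blinfun))"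
      by (simp add: compose_bilinear)
    also have "\<dots> \<in> M"
      by (rule subspace_diff[OF subspace_M absorb[OF \<beta>(1) b(2)] absorb[OF b(1) \<beta>(2)]])
    finally have "\<Lambda> (b w - \<beta>) = 0" by (rule \<Lambda>_M)
    then show ?thesis
      using \<Lambda>_add[of "b w - \<beta>" \<beta>] by (simp add: g_def)
  qed
  have deriv: "(g has_field_derivative \<Lambda> (b \<mu> o\<^sub>L b \<mu>)) (at \<mu>)" for \<mu>
  proof -
    define B where "B = b \<mu>"
    define D where "D = \<Lambda> (B o\<^sub>L B)"
    define K where "K = norm B + 1"
    have K: "K > 0" by (simp add: K_def add_nonneg_pos)
    have BA: "B \<in> A" unfolding B_def by (rule b)
    have est: "cmod (g w - g \<mu> - (w - \<mu>) * D) \<le> (4 * K ^ 3) * cmod (w - \<mu>) ^ 2"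
      if l: "cmod (w - \<mu>) * K \<le> 1 / 2" for w
    proof -
      define s where "s = w - \<mu>"
      have dA: "s *\<^sub>C B \<in> A" using BA by (rule scaleC_mem)
      have "norm (s *\<^sub>C B) \<le> 1 / 2"
        using l mult_left_mono[of "norm B" K "cmod s"] by (simp add: s_def norm_scaleC K_def)
      \<comment> \<open>\<open>c\<close> inverts \<open>id_blinfun - s *\<^sub>C B\<close>, so
        \<open>c o\<^sub>L B\<close> is an inverse of \<open>e w\<close> modulo \<open>M\<close>
        that depends explicitly on \<open>s\<close>.\<close>
      then obtain c where c: "c \<in> A" "c = id_blinfun + (s *\<^sub>C B o\<^sub>L c)" "norm c \<le> 2"
        using neumann_inverse dA by blast
      have el: "e w = e \<mu> - s *\<^sub>C id_blinfun"
        unfolding e_def s_def using scaleC_add_left[of "w - \<mu>" \<mu> "id_blinfun :: 'a \<Rightarrow>\<^sub>L 'a"] by simp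
      have c': "c = id_blinfun + s *\<^sub>C (c o\<^sub>L B)"
        using c(2) commute[OF c(1) BA] by (simp add: scaleC_compose)
      have "((c o\<^sub>L B) o\<^sub>L e w) - id_blinfun = c o\<^sub>L ((B o\<^sub>L e \<mu>) - id_blinfun)"
      proof -
        have "(c o\<^sub>L B) o\<^sub>L e w = (c o\<^sub>L (B o\<^sub>L e \<mu>)) - s *\<^sub>C (c o\<^sub>L B)"
          by (simp add: el compose_bilinear blinfun_compose_assoc compose_scaleC[OF c(1)]
              compose_scaleC[OF BA])
        moreover have "s *\<^sub>C (c o\<^sub>L B) = c - id_blinfun"
          using c' by (metis add_diff_cancel_left')
        ultimately show ?thesis
          by (simp only: compose_bilinear compose_id) simp
      qed
      also have "\<dots> \<in> M" unfolding B_def using c(1) b(2) by (rule absorb)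
      finally have g1: "g w = \<Lambda> (c o\<^sub>L B)"
        using compose_mem[OF c(1) BA] g_eq by blast
      have "c o\<^sub>L B = B + s *\<^sub>C (B o\<^sub>L B) + (s * s) *\<^sub>C (c o\<^sub>L (B o\<^sub>L (B o\<^sub>L B)))"
      proof -
        \<comment> \<open>Using this identity twice gives the second-order expansion in
          \<open>s\<close>, whose linear coefficient produces the derivative.\<close>
        have 1: "c o\<^sub>L F = F + s *\<^sub>C (c o\<^sub>L (B o\<^sub>L F))" for F
          using arg_cong[OF c', of "\<lambda>c. c o\<^sub>L F"]
          by (simp add: compose_bilinear scaleC_compose blinfun_compose_assoc)
        show ?thesis
          by (subst 1, subst 1) (simp add: scaleC_add_right scaleC_scaleC)
      qed
      then have "g w = g \<mu> + s * D + (s * s) * \<Lambda> (c o\<^sub>L (B o\<^sub>L (B o\<^sub>L B)))"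
        by (simp add: g1 \<Lambda>_add \<Lambda>_scale D_def) (simp add: g_def B_def)
      then have "cmod (g w - g \<mu> - s * D) = cmod s ^ 2 * cmod (\<Lambda> (c o\<^sub>L (B o\<^sub>L (B o\<^sub>L B))))"
        by (simp add: norm_mult power2_eq_square)
      also have "\<dots> \<le> cmod s ^ 2 * (2 * (2 * (K * (K * K))))"
      proof (intro mult_left_mono order_trans[OF \<Lambda>_norm])
        have BK: "norm B \<le> K" by (simp add: K_def)
        have "norm (c o\<^sub>L (B o\<^sub>L (B o\<^sub>L B))) \<le> norm c * (norm B * (norm B * norm B))"
          by (meson norm_blinfun_compose mult_left_mono norm_ge_zero order_trans)
        also have "\<dots> \<le> 2 * (K * (K * K))"
          using c(3) BK K by (intro mult_mono) auto
        finally show "norm (c o\<^sub>L (B o\<^sub>L (B o\<^sub>L B))) \<le> 2 * (K * (K * K))" .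
      qed auto
      finally show ?thesis
        by (simp add: s_def power3_eq_cube mult.commute)
    qed
    have "((\<lambda>w. (g w - g \<mu>) / (w - \<mu>) - D) \<longlongrightarrow> 0) (at \<mu>)"
    proof (rule Lim_null_comparison)
      have "cmod ((g w - g \<mu>) / (w - \<mu>) - D) \<le> (4 * K ^ 3) * cmod (w - \<mu>)"
        if "w \<noteq> \<mu>" "dist w \<mu> < 1 / (2 * K)" for w
      proof -
        have "cmod (w - \<mu>) * K \<le> 1 / 2"
          using that K by (simp add: dist_norm field_simps)
        from est[OF this] show ?thesis
          using that by (simp add: field_simps norm_divide power2_eq_square)
      qed
      then show "\<forall>\<^sub>F w in at \<mu>. cmod ((g w - g \<mu>) / (w - \<mu>) - D) \<le> (4 * K ^ 3) * cmod (w - \<mu>)"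
        unfolding eventually_at using K by (intro exI[of _ "1 / (2 * K)"]) auto
      show "((\<lambda>w. (4 * K ^ 3) * cmod (w - \<mu>)) \<longlongrightarrow> 0) (at \<mu>)"
        by (auto intro!: tendsto_eq_intros)
    qed
    then show ?thesis
      unfolding has_field_derivative_iff D_def B_def by (rule LIM_zero_cancel)
  qed
  \<comment> \<open>For large \<open>w\<close> the inverse of \<open>a - w\<close> is exact: it is
    \<open>- 1 / w\<close> times the Neumann inverse of \<open>1 - a / w\<close>. This gives decay
    at infinity, and also shows that \<open>g\<close> is not identically zero.\<close>
  have far: "\<exists>c. g w = - \<Lambda> c / w \<and> norm c \<le> 2 \<and> w * (\<Lambda> c - \<Lambda> id_blinfun) = \<Lambda> (a o\<^sub>L c)"
    if l: "cmod w \<ge> 2 * norm a + 1" for w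
  proof -
    have l0: "w \<noteq> 0" "cmod w > 0" using l norm_ge_zero[of a] by (auto simp del: norm_ge_zero)
    have dA: "(1 / w) *\<^sub>C a \<in> A" using a by (rule scaleC_mem)
    have "norm ((1 / w) *\<^sub>C a) \<le> 1 / 2"
      using l l0 by (simp add: norm_scaleC norm_divide field_simps)
    then obtain c where c: "c \<in> A" "c = id_blinfun + ((1 / w) *\<^sub>C a o\<^sub>L c)" "norm c \<le> 2"
      using neumann_inverse dA by blast
    have c': "c = id_blinfun + (1 / w) *\<^sub>C (a o\<^sub>L c)"
      using c(2) by (simp add: scaleC_compose)
    have \<beta>A: "(- 1 / w) *\<^sub>C c \<in> A" using c(1) by (rule scaleC_mem)
    have "((- 1 / w) *\<^sub>C c) o\<^sub>L e w = (- 1 / w) *\<^sub>C (a o\<^sub>L c) + c"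
    proof -
      have "c o\<^sub>L e w = (a o\<^sub>L c) + (- w) *\<^sub>C c"
        by (simp add: e_def compose_bilinear compose_scaleC[OF c(1)] commute[OF c(1) a]
            scaleC_minus_left)
      then show ?thesis
        using l0 by (simp add: scaleC_compose scaleC_add_right scaleC_scaleC)
    qed
    also have "\<dots> = id_blinfun"
    proof -
      have "(- 1 / w) *\<^sub>C (a o\<^sub>L c) = - ((1 / w) *\<^sub>C (a o\<^sub>L c))"
        using scaleC_minus_left[of "1 / w"] by simp
      also have "(1 / w) *\<^sub>C (a o\<^sub>L c) = c - id_blinfun"
        using c' by (metis add_diff_cancel_left')
      finally show ?thesis by simp
    qed
    finally have "g w = \<Lambda> ((- 1 / w) *\<^sub>C c)"
      using g_eq[OF \<beta>A] subspace_0[OF subspace_M] by simp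
    then have "g w = - \<Lambda> c / w"
      by (simp add: \<Lambda>_scale)
    moreover have "\<Lambda> c = \<Lambda> id_blinfun + (1 / w) * \<Lambda> (a o\<^sub>L c)"
      using arg_cong[OF c', of \<Lambda>] by (simp only: \<Lambda>_add \<Lambda>_scale)
    then have "w * (\<Lambda> c - \<Lambda> id_blinfun) = \<Lambda> (a o\<^sub>L c)"
      using l0 by simp
    ultimately show ?thesis
      using c(3) by blast
  qed
  have "(g \<longlongrightarrow> 0) at_infinity"
  proof (rule Lim_null_comparison)
    have "cmod (g w) \<le> 4 * cmod (inverse w)" if l: "cmod w \<ge> 2 * norm a + 1" for w
    proof -
      obtain c where c: "g w = - \<Lambda> c / w" "norm c \<le> 2" using far[OF l] by blast
      have "cmod (\<Lambda> c) \<le> 4" using \<Lambda>_norm[of c] c(2) by linarith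
      then show ?thesis
        using c(1) by (simp add: norm_divide norm_inverse divide_inverse norm_mult mult_right_mono)
    qed
    then show "\<forall>\<^sub>F w in at_infinity. cmod (g w) \<le> 4 * cmod (inverse w)"
      unfolding eventually_at_infinity by blast
    show "((\<lambda>w. 4 * cmod (inverse w)) \<longlongrightarrow> 0) at_infinity"
      by (intro tendsto_mult_right_zero tendsto_norm_zero tendsto_inverse_0)
  qed
  moreover have "g holomorphic_on UNIV"
    using deriv by (auto simp: holomorphic_on_open)
  ultimately have g0: "g w = 0" for w
    by (metis Liouville_weak_0)
  \<comment> \<open>Once \<open>g\<close> vanishes, \<open>\<Lambda> c = 0\<close> forces
    \<open>t * cmod (\<Lambda> id_blinfun) \<le> 4 * norm a\<close>; this \<open>t\<close> is too
    large for that.\<close>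
  define t where "t = 2 * norm a + 1 + 4 * norm a / cmod (\<Lambda> id_blinfun)"
  have t: "t \<ge> 2 * norm a + 1" "t > 0" by (auto simp: t_def add_nonneg_pos add_pos_nonneg)
  then have "cmod (complex_of_real t) \<ge> 2 * norm a + 1" by simp
  then obtain c where c: "g t = - \<Lambda> c / t" "norm c \<le> 2"
      "t * (\<Lambda> c - \<Lambda> id_blinfun) = \<Lambda> (a o\<^sub>L c)"
    using far by blast
  have "\<Lambda> c = 0" using c(1) g0 t(2) by simp
  then have "t * cmod (\<Lambda> id_blinfun) = cmod (\<Lambda> (a o\<^sub>L c))"
    using c(3) t(2) by (metis abs_of_pos norm_minus_commute norm_mult norm_of_real diff_zero)
  also have "\<dots> \<le> 2 * norm (a o\<^sub>L c)" by (rule \<Lambda>_norm)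
  also have "\<dots> \<le> 4 * norm a"
    using norm_blinfun_compose[of a c] mult_left_mono[OF c(2), of "norm a"] by simp
  finally have "t \<le> 4 * norm a / cmod (\<Lambda> id_blinfun)"
    using \<Lambda>_id by (simp add: field_simps)
  then show False
    unfolding t_def using norm_ge_zero[of a] by (simp del: norm_ge_zero)
qed

end

section \<open>Pulling back maximal ideals of \<open>A / I\<^sub>j\<close>\<close>

text \<open>The ideal generated by \<open>I\<close> and \<open>a\<close> strictly contains
  \<open>I\<close>, so by maximality it contains the unit.\<close>

lemma maximalideal_inverse_mod:
  assumes "maximalideal I R" "cring R" and a: "a \<in> carrier R" "a \<notin> I"
  shows "\<exists>m\<in>I. \<exists>b\<in>carrier R. \<one>\<^bsub>R\<^esub> = m \<oplus>\<^bsub>R\<^esub> b \<otimes>\<^bsub>R\<^esub> a"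
proof -
  interpret R: cring R by (rule assms)
  interpret maximalideal I R by (rule assms)
  let ?J = "I <+>\<^bsub>R\<^esub> PIdl\<^bsub>R\<^esub> a"
  have J: "ideal ?J R"
    by (intro R.add_ideals is_ideal R.cgenideal_ideal a)
  have mem: "i \<oplus>\<^bsub>R\<^esub> b \<otimes>\<^bsub>R\<^esub> a \<in> ?J" if "i \<in> I" "b \<in> carrier R" for i b
    using that by (auto simp: set_add_defs cgenideal_def)
  have "I \<subseteq> ?J"
  proof
    fix i assume i: "i \<in> I"
    then show "i \<in> ?J"
      using mem[OF i R.zero_closed] a(1) a_Hcarr[OF i] by simp
  qed
  moreover have "a \<in> ?J"
    using mem[OF additive_subgroup.zero_closed[OF is_additive_subgroup] R.one_closed] a(1) by simp
  ultimately have "?J = carrier R"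
    using I_maximal[OF J] ideal.Icarr[OF J] a(2) by blast
  then have "\<one>\<^bsub>R\<^esub> \<in> ?J"
    by simp
  then show ?thesis
    by (auto simp: set_add_defs cgenideal_def)
qed

lemma quot_map_hom:
  assumes "unital_subalgebra A" "abelian A"
  shows "quot_map A y \<in> ring_hom (op_ring A) (quot_alg A y)"
  using ideal.rcos_ring_hom[OF ideal_annihilator[OF assms]]
  unfolding quot_map_def quot_alg_def by (simp add: eta_contract_eq)

context commutative_operator_algebra
begin

text \<open>This transfers abstract maximal ideals of the quotient to concrete sets of operators.
  Closure under complex scalars comes from multiplying by scalar multiples of the identity.\<close>

lemma maximal_operator_ideal_pullback:
  assumes I: "maximalideal I (quot_alg A y)"
  defines "M \<equiv> {a \<in> A. quot_map A y a \<in> I}"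
  shows "maximal_operator_ideal A M" "annihilator A y \<subseteq> M"
proof -
  let ?R = "op_ring A" and ?Q = "quot_alg A y" and ?h = "quot_map A y"
  interpret R: cring ?R by (rule cring_op_ring[OF subalgebra commutative])
  interpret Ann: ideal "annihilator A y" ?R by (rule ideal_annihilator[OF subalgebra commutative])
  interpret Q: cring ?Q unfolding quot_alg_def by (rule Ann.quotient_is_cring[OF R.is_cring])
  interpret maximalideal I ?Q by (rule I)
  note hom = quot_map_hom[OF subalgebra commutative, of y]
  have carrier_R: "carrier ?R = A" by (simp add: op_ring_def)
  have h_add: "?h (a + b) = ?h a \<oplus>\<^bsub>?Q\<^esub> ?h b" if "a \<in> A" "b \<in> A" for a b
    using ring_hom_add[OF hom, of a b] that by (simp add: op_ring_def)
  have h_mult: "?h (a o\<^sub>L b) = ?h a \<otimes>\<^bsub>?Q\<^esub> ?h b" if "a \<in> A" "b \<in> A" for a b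
    using ring_hom_mult[OF hom, of a b] that by (simp add: op_ring_def)
  have h_one: "?h id_blinfun = \<one>\<^bsub>?Q\<^esub>"
    using ring_hom_one[OF hom] by (simp add: op_ring_def)
  have h_closed: "?h a \<in> carrier ?Q" if "a \<in> A" for a
    using that by (auto simp: carrier_quot_alg)
  have h_ann: "?h a = \<zero>\<^bsub>?Q\<^esub>" if "a \<in> annihilator A y" for a
    using Ann.a_rcos_const[OF that] by (simp add: quot_map_def quot_alg_def FactRing_def)
  have zero_I: "\<zero>\<^bsub>?Q\<^esub> \<in> I"
    by (rule additive_subgroup.zero_closed[OF is_additive_subgroup])
  show ann: "annihilator A y \<subseteq> M"
    using h_ann zero_I by (auto simp: M_def annihilator_def)
  have absorb: "a o\<^sub>L m \<in> M" if "a \<in> A" "m \<in> M" for a m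
    using that h_mult I_l_closed h_closed compose_mem by (simp add: M_def)
  show "maximal_operator_ideal A M"
  proof
    show "M \<subseteq> A" by (auto simp: M_def)
    show "csubspace M"
      unfolding csubspace_def
    proof (intro conjI ballI allI)
      show "0 \<in> M" using ann subspace_0[OF subspace_A] by (auto simp: annihilator_def)
      show "a + b \<in> M" if "a \<in> M" "b \<in> M" for a b
        using that h_add mem_intros additive_subgroup.a_closed[OF is_additive_subgroup]
        by (simp add: M_def)
      show "c *\<^sub>C m \<in> M" if "m \<in> M" for c m
        using absorb[OF scaleC_mem[OF id_mem] that, of c] by (simp add: scaleC_compose)
    qed
    show "a o\<^sub>L m \<in> M" if "a \<in> A" "m \<in> M" for a m using absorb that .
    show "id_blinfun \<notin> M"
      using one_imp_carrier I_notcarr h_one by (auto simp: M_def)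
    show "\<exists>b\<in>A. (b o\<^sub>L a) - id_blinfun \<in> M" if a: "a \<in> A" "a \<notin> M" for a
    proof -
      have "?h a \<notin> I" using a by (simp add: M_def)
      then obtain m b' where m: "m \<in> I" and b': "b' \<in> carrier ?Q"
          and one: "\<one>\<^bsub>?Q\<^esub> = m \<oplus>\<^bsub>?Q\<^esub> b' \<otimes>\<^bsub>?Q\<^esub> ?h a"
        using maximalideal_inverse_mod[OF I Q.is_cring h_closed[OF a(1)]] by blast
      obtain b where b: "b \<in> A" "b' = ?h b" using b' by (auto simp: carrier_quot_alg)
      \<comment> \<open>Comparing \<open>b o\<^sub>L a = d + id_blinfun\<close> with the
        decomposition of the unit shows that the class of \<open>d\<close> is the negative of
        \<open>m\<close>.\<close>
      define d where "d = (b o\<^sub>L a) - id_blinfun"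
      have ba: "b o\<^sub>L a \<in> A" using b(1) a(1) by (rule compose_mem)
      have d: "d \<in> A" unfolding d_def using ba id_mem by (rule subspace_diff[OF subspace_A])
      have carr: "m \<in> carrier ?Q" "?h d \<in> carrier ?Q" "?h (b o\<^sub>L a) \<in> carrier ?Q"
        using m Icarr h_closed d ba by auto
      have "?h (b o\<^sub>L a) = ?h d \<oplus>\<^bsub>?Q\<^esub> \<one>\<^bsub>?Q\<^esub>"
        using h_add[OF d id_mem] by (simp add: d_def h_one)
      also have "\<dots> = ?h d \<oplus>\<^bsub>?Q\<^esub> (m \<oplus>\<^bsub>?Q\<^esub> ?h (b o\<^sub>L a))"
        using one b a(1) by (simp add: h_mult)
      also have "\<dots> = (?h d \<oplus>\<^bsub>?Q\<^esub> m) \<oplus>\<^bsub>?Q\<^esub> ?h (b o\<^sub>L a)"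
        using carr by (simp add: Q.a_assoc)
      finally have "?h d \<oplus>\<^bsub>?Q\<^esub> m = \<zero>\<^bsub>?Q\<^esub>"
        using carr Q.add.r_cancel_one' by auto
      then have "?h d = \<ominus>\<^bsub>?Q\<^esub> m"
        using carr Q.minus_equality by metis
      then have "?h d \<in> I"
        using m additive_subgroup.a_inv_closed[OF is_additive_subgroup] by simp
      then show ?thesis using b(1) d by (auto simp: M_def d_def)
    qed
  qed
qed

end

section \<open>Split strict multiplicity\<close>

instance bcontfun :: (metric_space, banach) banach ..

locale split_operator_algebra = commutative_operator_algebra A
  for A :: "('a :: complex_banach \<Rightarrow>\<^sub>L 'a) set" +
  fixes p :: nat and x :: "nat \<Rightarrow> 'a"
  assumes realizes: "realizes_ssm A p x"
begin

text \<open>The splitting determines each vector obtained by applying \<open>a j\<close> to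
  \<open>x j\<close>, while \<open>a j\<close> itself is determined only modulo the annihilator of
  \<open>x j\<close>.\<close>

lemma split_unique:
  assumes "\<And>i. i \<in> {1..p} \<Longrightarrow> a i \<in> A" "\<And>i. i \<in> {1..p} \<Longrightarrow> b i \<in> A"
    and "(\<Sum>i=1..p. blinfun_apply (a i) (x i)) = (\<Sum>i=1..p. blinfun_apply (b i) (x i))"
    and j: "j \<in> {1..p}"
  shows "blinfun_apply (a j) (x j) = blinfun_apply (b j) (x j)"
proof -
  let ?u = "\<lambda>a. \<lambda>i\<in>{1..p}. blinfun_apply (a i) (x i)"
  let ?y = "\<Sum>i=1..p. blinfun_apply (a i) (x i)"
  have "?u a \<in> (\<Pi>\<^sub>E i\<in>{1..p}. orbit_of A (x i)) \<and> ?y = (\<Sum>i=1..p. ?u a i)"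
    "?u b \<in> (\<Pi>\<^sub>E i\<in>{1..p}. orbit_of A (x i)) \<and> ?y = (\<Sum>i=1..p. ?u b i)"
    using assms by (auto simp: orbit_of_def)
  moreover have "\<exists>!u. u \<in> (\<Pi>\<^sub>E i\<in>{1..p}. orbit_of A (x i)) \<and> ?y = (\<Sum>i=1..p. u i)"
    using realizes by (simp add: realizes_ssm_def)
  ultimately have "?u a = ?u b"
    by (metis (no_types, lifting))
  then have "?u a j = ?u b j"
    by (rule fun_cong)
  then show ?thesis
    using j by simp
qed

text \<open>Tuples over \<open>A\<close> of variable length \<open>p\<close> are modelled by bounded functions on the discrete space
  of naturals, so that the open mapping theorem applies to a Banach space type.\<close>

lemma split_bound:
  obtains C where "C \<ge> 0"
    "\<And>y. \<exists>a. (\<forall>i. a i \<in> A \<and> norm (a i) \<le> C * norm y) \<and> y = (\<Sum>i=1..p. blinfun_apply (a i) (x i))"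
proof -
  define f :: "(nat discrete \<Rightarrow>\<^sub>C ('a \<Rightarrow>\<^sub>L 'a)) \<Rightarrow> 'a"
    where "f g = (\<Sum>i=1..p. blinfun_apply (apply_bcontfun g (discrete i)) (x i))" for g
  define K :: "(nat discrete \<Rightarrow>\<^sub>C ('a \<Rightarrow>\<^sub>L 'a)) set" where "K = PiC UNIV (\<lambda>_. A)"
  have K_iff: "g \<in> K \<longleftrightarrow> (\<forall>i. apply_bcontfun g i \<in> A)" for g
    by (auto simp: K_def mem_PiC_iff)
  have eval: "bounded_linear (\<lambda>g :: nat discrete \<Rightarrow>\<^sub>C ('a \<Rightarrow>\<^sub>L 'a). apply_bcontfun g i)" for i
    by (rule bounded_linear_intro[where K = 1]) (auto simp: norm_bounded)
  have f: "bounded_linear f"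
    unfolding f_def
    by (intro bounded_linear_sum bounded_linear_compose[OF blinfun.bounded_linear_left eval])
  have "closed K" unfolding K_def by (rule closed_PiC) (rule closed)
  moreover have "subspace K"
    using subspace_A by (auto simp: subspace_def K_iff)
  moreover have "f ` K = UNIV"
  proof (intro equalityI subsetI UNIV_I)
    fix y
    obtain u where u: "u \<in> (\<Pi>\<^sub>E i\<in>{1..p}. orbit_of A (x i))" "y = (\<Sum>i=1..p. u i)"
      using realizes unfolding realizes_ssm_def by (meson ex1_implies_ex)
    have "\<exists>a. a \<in> A \<and> u i = blinfun_apply a (x i)" if "i \<in> {1..p}" for i
      using PiE_mem[OF u(1) that] by (auto simp: orbit_of_def)
    then obtain a where a: "\<And>i. i \<in> {1..p} \<Longrightarrow> a i \<in> A \<and> u i = blinfun_apply (a i) (x i)"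
      by metis
    \<comment> \<open>Zero outside \<open>{1..p}\<close> keeps the family bounded and in
      \<open>A\<close>; continuity is automatic on a discrete space.\<close>
    define b where "b k = (if of_discrete k \<in> {1..p} then a (of_discrete k) else 0)" for k
    have "b \<in> bcontfun"
    proof (rule bcontfun_normI)
      show "norm (b k) \<le> (\<Sum>i=1..p. norm (a i))" for k
        using member_le_sum[of "of_discrete k" "{1..p}" "\<lambda>i. norm (a i)"]
        by (auto simp: b_def intro: sum_nonneg)
      show "continuous_on UNIV b"
        by (simp add: continuous_on_open_invariant open_discrete)
    qed
    then have ap: "apply_bcontfun (Bcontfun b) = b" by (rule Bcontfun_inverse)
    have "Bcontfun b \<in> K"
      unfolding K_iff ap using a subspace_0[OF subspace_A] by (auto simp: b_def)
    moreover have "f (Bcontfun b) = y"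
      unfolding f_def ap u(2) using a by (intro sum.cong) (auto simp: b_def discrete_inverse)
    ultimately show "y \<in> f ` K" by blast
  qed
  ultimately obtain C where C: "C \<ge> 0" "\<And>y. \<exists>g\<in>K. f g = y \<and> norm g \<le> C * norm y"
    using open_mapping_bound[OF f] by blast
  show ?thesis
  proof (rule that[OF C(1)])
    fix y
    obtain g where g: "g \<in> K" "f g = y" "norm g \<le> C * norm y" using C(2) by blast
    then show "\<exists>a. (\<forall>i. a i \<in> A \<and> norm (a i) \<le> C * norm y) \<and> y = (\<Sum>i=1..p. blinfun_apply (a i) (x i))"
      by (intro exI[of _ "\<lambda>i. apply_bcontfun g (discrete i)"]) (auto simp: K_iff f_def intro: order_trans[OF norm_bounded])
  qed
qed

section \<open>The separating vector\<close>

definition u :: 'a where "u = (\<Sum>i=1..p. x i)"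

lemma apply_u: "blinfun_apply a u = (\<Sum>i=1..p. blinfun_apply a (x i))"
  by (simp add: u_def blinfun.sum_right)

text \<open>The vector \<open>u\<close> is separating for \<open>A\<close>, with a bound: on \<open>y = \<Sum>i. c\<^sub>i x\<^sub>i\<close> with small \<open>c\<^sub>i\<close>,
  commutativity gives \<open>a y = \<Sum>i. c\<^sub>i (a x\<^sub>i)\<close>, and the \<open>a x\<^sub>i\<close> are the components of \<open>a u\<close>.\<close>

lemma norm_le_apply_u:
  obtains C where "C \<ge> 0" "\<And>a. a \<in> A \<Longrightarrow> norm a \<le> C * norm (blinfun_apply a u)"
proof -
  obtain C where C: "C \<ge> 0"
    "\<And>y. \<exists>a. (\<forall>i. a i \<in> A \<and> norm (a i) \<le> C * norm y) \<and> y = (\<Sum>i=1..p. blinfun_apply (a i) (x i))"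
    using split_bound by blast
  define S where "S = (\<Sum>i=1..p. norm (x i))"
  have S: "S \<ge> 0" unfolding S_def by (intro sum_nonneg) auto
  have "norm a \<le> (C * (C * S)) * norm (blinfun_apply a u)" if a: "a \<in> A" for a
  proof (rule norm_blinfun_bound)
    show "0 \<le> (C * (C * S)) * norm (blinfun_apply a u)" using C(1) S by simp
    fix y
    obtain d where d: "\<And>i. d i \<in> A" "\<And>i. norm (d i) \<le> C * norm (blinfun_apply a u)"
        "blinfun_apply a u = (\<Sum>i=1..p. blinfun_apply (d i) (x i))"
      using C(2) by blast
    have ax: "norm (blinfun_apply a (x i)) \<le> (C * norm (blinfun_apply a u)) * norm (x i)"
      if "i \<in> {1..p}" for i
    proof -
      \<comment> \<open>Both sides are the \<open>i\<close>-th component of \<open>a u\<close>, and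
        \<open>d i\<close> has norm controlled by that of \<open>a u\<close>.\<close>
      have "blinfun_apply a (x i) = blinfun_apply (d i) (x i)"
        by (rule split_unique[of "\<lambda>_. a" d]) (use a d that in \<open>auto simp: apply_u\<close>)
      then show ?thesis
        using norm_blinfun[of "d i" "x i"] mult_right_mono[OF d(2)[of i], of "norm (x i)"] by simp
    qed
    obtain c where c: "\<And>i. c i \<in> A" "\<And>i. norm (c i) \<le> C * norm y"
        "y = (\<Sum>i=1..p. blinfun_apply (c i) (x i))"
      using C(2) by blast
    have "blinfun_apply a y = (\<Sum>i=1..p. blinfun_apply (c i) (blinfun_apply a (x i)))"
      by (subst c(3)) (simp add: blinfun.sum_right apply_commute[OF a c(1)])
    also have "norm \<dots> \<le> (\<Sum>i=1..p. (C * norm y) * ((C * norm (blinfun_apply a u)) * norm (x i)))"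
    proof (rule sum_norm_le)
      fix i assume "i \<in> {1..p}"
      have "norm (blinfun_apply (c i) (blinfun_apply a (x i))) \<le> norm (c i) * norm (blinfun_apply a (x i))"
        by (rule norm_blinfun)
      also have "\<dots> \<le> (C * norm y) * ((C * norm (blinfun_apply a u)) * norm (x i))"
        using c(2) ax[OF \<open>i \<in> {1..p}\<close>] C(1) by (intro mult_mono) auto
      finally show "norm (blinfun_apply (c i) (blinfun_apply a (x i)))
          \<le> (C * norm y) * ((C * norm (blinfun_apply a u)) * norm (x i))" .
    qed
    also have "\<dots> = (C * (C * S)) * norm (blinfun_apply a u) * norm y"
      by (simp add: S_def flip: sum_distrib_left)
    finally show "norm (blinfun_apply a y) \<le> (C * (C * S)) * norm (blinfun_apply a u) * norm y" .
  qed
  then show ?thesis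
    using that[of "C * (C * S)"] C(1) S by simp
qed

text \<open>Evaluation at \<open>u\<close> is bounded below on \<open>A\<close>, so it carries the
  complete set \<open>L\<close> to a complete set. The constant \<open>1 / (C + 1)\<close> avoids
  division by zero when \<open>C = 0\<close>.\<close>

lemma closed_orbit_u:
  assumes L: "L \<subseteq> A" "subspace L" "closed L"
  shows "closed (orbit_of L u)"
proof -
  obtain C where C: "C \<ge> 0" "\<And>a. a \<in> A \<Longrightarrow> norm a \<le> C * norm (blinfun_apply a u)"
    using norm_le_apply_u by blast
  have "complete ((\<lambda>l. blinfun_apply l u) ` L)"
  proof (rule complete_isometric_image[of "1 / (C + 1)"])
    show "\<forall>l\<in>L. 1 / (C + 1) * norm l \<le> norm (blinfun_apply l u)"
    proof
      fix l assume "l \<in> L"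
      then have "norm l \<le> C * norm (blinfun_apply l u)" using C(2) L(1) by blast
      then show "1 / (C + 1) * norm l \<le> norm (blinfun_apply l u)"
        using C(1) norm_ge_zero[of "blinfun_apply l u"] by (simp add: field_simps del: norm_ge_zero)
    qed
  qed (use C(1) L blinfun.bounded_linear_left in \<open>auto simp: complete_eq_closed\<close>)
  then show ?thesis
    by (simp add: orbit_of_def complete_eq_closed)
qed

text \<open>The condition is put on the coefficient \<open>a j\<close> instead of its vector. It is
  independent of the chosen coefficient when \<open>M\<close> is an additive subgroup containing the
  annihilator of \<open>x j\<close>.\<close>

definition component_in :: "('a \<Rightarrow>\<^sub>L 'a) set \<Rightarrow> nat \<Rightarrow> 'a set" where
  "component_in M j =
     {(\<Sum>i=1..p. blinfun_apply (a i) (x i)) | a. (\<forall>i. a i \<in> A) \<and> a j \<in> M}"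

context
  fixes M j
  assumes M: "maximal_operator_ideal A M" and ann: "annihilator A (x j) \<subseteq> M" and j: "j \<in> {1..p}"
begin

interpretation maximal_operator_ideal A M by (rule M)

text \<open>Two coefficients of the same \<open>j\<close>-th component differ by an annihilator
  element, hence by an element of \<open>M\<close>.\<close>

lemma mem_component_inD:
  assumes a: "\<And>i. i \<in> {1..p} \<Longrightarrow> a i \<in> A"
    and y: "(\<Sum>i=1..p. blinfun_apply (a i) (x i)) \<in> component_in M j"
  shows "a j \<in> M"
proof -
  obtain b where b: "\<And>i. b i \<in> A" "b j \<in> M"
      "(\<Sum>i=1..p. blinfun_apply (a i) (x i)) = (\<Sum>i=1..p. blinfun_apply (b i) (x i))"
    using y by (auto simp: component_in_def)
  have "blinfun_apply (a j) (x j) = blinfun_apply (b j) (x j)"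
    by (rule split_unique[of a b]) (use a b j in auto)
  then have "a j - b j \<in> annihilator A (x j)"
    using a[OF j] b(1) by (auto simp: annihilator_def blinfun.diff_left intro: mem_intros)
  then have "(a j - b j) + b j \<in> M"
    using ann b(2) subspace_add[OF subspace_M] by blast
  then show ?thesis by simp
qed

text \<open>By the open mapping bound, nearby vectors have nearby coefficients, so a limit vector
  has its \<open>j\<close>-th coefficient in the closed set \<open>M\<close>.\<close>

lemma closed_component_in: "closed (component_in M j)"
proof -
  obtain C where C: "C \<ge> 0"
    "\<And>y. \<exists>a. (\<forall>i. a i \<in> A \<and> norm (a i) \<le> C * norm y) \<and> y = (\<Sum>i=1..p. blinfun_apply (a i) (x i))"
    using split_bound by blast
  have "y \<in> component_in M j" if y: "y \<in> closure (component_in M j)" for y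
  proof -
    obtain a where a: "\<And>i. a i \<in> A" "y = (\<Sum>i=1..p. blinfun_apply (a i) (x i))"
      using C(2) by blast
    have "a j \<in> closure M"
      unfolding closure_approachable
    proof (intro allI impI)
      fix e :: real assume e: "e > 0"
      then have "e / (C + 1) > 0" using C(1) by simp
      then obtain z where z: "z \<in> component_in M j" "dist z y < e / (C + 1)"
        using y unfolding closure_approachable by blast
      obtain b where b: "\<And>i. b i \<in> A" "\<And>i. norm (b i) \<le> C * norm (y - z)"
          "y - z = (\<Sum>i=1..p. blinfun_apply (b i) (x i))"
        using C(2) by blast
      have "z = (\<Sum>i=1..p. blinfun_apply (a i - b i) (x i))"
        using a(2) b(3) by (simp add: blinfun.diff_left sum_subtractf algebra_simps)
      then have "a j - b j \<in> M"
        using z(1) a(1) b(1) by (intro mem_component_inD[of "\<lambda>i. a i - b i"]) (auto intro: mem_intros)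
      moreover have "dist (a j - b j) (a j) < e"
      proof -
        have "norm (b j) \<le> C * norm (y - z)" by (rule b)
        also have "\<dots> \<le> (C + 1) * dist z y" by (simp add: dist_norm norm_minus_commute mult_right_mono)
        also have "\<dots> < e" using z(2) C(1) by (simp add: field_simps)
        finally show ?thesis by (simp add: dist_norm)
      qed
      ultimately show "\<exists>m\<in>M. dist m (a j) < e" by blast
    qed
    then have "a j \<in> M" using closed_M by simp
    then show ?thesis
      unfolding component_in_def using a by blast
  qed
  then show ?thesis
    by (metis closure_subset closed_closure subsetI subset_antisym)
qed

lemma component_in_apply:
  assumes "a \<in> A" "y \<in> component_in M j"
  shows "blinfun_apply a y \<in> component_in M j"
proof -
  obtain b where b: "\<And>i. b i \<in> A" "b j \<in> M" "y = (\<Sum>i=1..p. blinfun_apply (b i) (x i))"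
    using assms(2) by (auto simp: component_in_def)
  have "blinfun_apply a y = (\<Sum>i=1..p. blinfun_apply (a o\<^sub>L b i) (x i))"
    by (simp add: b(3) blinfun.sum_right)
  then show ?thesis
    unfolding component_in_def using b(1,2) assms(1)
    by (intro CollectI exI[of _ "\<lambda>i. a o\<^sub>L b i"]) (simp add: absorb compose_mem)
qed

text \<open>Modulo the closed submodule \<open>component_in M j\<close> every vector is a multiple of \<open>u\<close>.\<close>

lemma kills_u_imp_component_in:
  assumes T: "T \<in> bounded_ops" "\<And>y. blinfun_apply T y \<in> closure (orbit_of A y)"
    and Tu: "blinfun_apply T u = 0"
  shows "blinfun_apply T y \<in> component_in M j"
proof -
  obtain a where a: "\<And>i. a i \<in> A" "y = (\<Sum>i=1..p. blinfun_apply (a i) (x i))"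
    using split_bound by metis
  obtain w where w: "a j - w *\<^sub>C id_blinfun \<in> M"
    using scalar_mod[OF a(1)] by blast
  \<comment> \<open>Subtracting the same scalar \<open>w\<close> from every coefficient, not only
    the \<open>j\<close>-th, removes exactly \<open>w *\<^sub>C u\<close>, which \<open>T\<close>
    kills.\<close>
  define z where "z = (\<Sum>i=1..p. blinfun_apply (a i - w *\<^sub>C id_blinfun) (x i))"
  have "w *\<^sub>C u = (\<Sum>i=1..p. blinfun_apply (w *\<^sub>C id_blinfun) (x i))"
    using apply_u[of "w *\<^sub>C id_blinfun"] by (simp add: blinfun_apply_scaleC)
  then have y: "y = z + w *\<^sub>C u"
    by (simp add: z_def a(2) blinfun.diff_left sum_subtractf)
  have "z \<in> component_in M j"
    unfolding component_in_def z_def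
    using w a(1) by (intro CollectI exI[of _ "\<lambda>i. a i - w *\<^sub>C id_blinfun"]) (auto intro!: mem_intros)
  then have "orbit_of A z \<subseteq> component_in M j"
    using component_in_apply by (auto simp: orbit_of_def)
  then have "closure (orbit_of A z) \<subseteq> component_in M j"
    using closed_component_in by (rule closure_minimal)
  moreover have "blinfun_apply T (w *\<^sub>C u) = 0"
    using T(1) Tu by (simp add: bounded_ops_def)
  then have "blinfun_apply T y = blinfun_apply T z"
    by (simp add: y blinfun.add_right)
  ultimately show ?thesis
    using T(2)[of z] by auto
qed

end

text \<open>Coefficients of \<open>T y\<close> are fixed once; for each \<open>j\<close>, the
  coefficient \<open>a j\<close> is then tested against the pullback of every maximal ideal of the
  \<open>j\<close>-th quotient.\<close>

lemma kills_u_imp_radical: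
  assumes T: "T \<in> bounded_ops" "\<And>y. blinfun_apply T y \<in> closure (orbit_of A y)"
    and Tu: "blinfun_apply T u = 0"
  shows "blinfun_apply T y \<in> split_map A p x ` (\<Pi>\<^sub>E j\<in>{1..p}. radical_of (quot_alg A (x j)))"
proof -
  obtain a where a: "\<And>i. a i \<in> A" "blinfun_apply T y = (\<Sum>i=1..p. blinfun_apply (a i) (x i))"
    using split_bound by metis
  have "quot_map A (x j) (a j) \<in> radical_of (quot_alg A (x j))" if j: "j \<in> {1..p}" for j
    unfolding radical_of_def
  proof (intro IntI InterI)
    \<comment> \<open>If \<open>x j = 0\<close>, the quotient is the zero ring without maximal
      ideals, and this clause is the whole claim.\<close>
    show "quot_map A (x j) (a j) \<in> carrier (quot_alg A (x j))"
      using a(1) by (simp add: carrier_quot_alg)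
    fix I assume "I \<in> {M. maximalideal M (quot_alg A (x j))}"
    then have I: "maximalideal I (quot_alg A (x j))" by simp
    define M where "M = {a \<in> A. quot_map A (x j) a \<in> I}"
    have M: "maximal_operator_ideal A M" "annihilator A (x j) \<subseteq> M"
      unfolding M_def using maximal_operator_ideal_pullback[OF I] by auto
    have "a j \<in> M"
      using mem_component_inD[OF M j, of a] kills_u_imp_component_in[OF M j T Tu, of y] a by simp
    then show "quot_map A (x j) (a j) \<in> I" by (simp add: M_def)
  qed
  moreover have "blinfun_apply T y = split_map A p x (\<lambda>j\<in>{1..p}. quot_map A (x j) (a j))"
    using split_map_quot_map[OF subalgebra, of p a x] a by simp
  ultimately show ?thesis by (intro image_eqI) auto
qed

end

section \<open>Correction of the operator by an element of the subspace\<close>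

theorem theorem8:
  fixes A L :: "('a :: complex_banach \<Rightarrow>\<^sub>L 'a) set"
    and T :: "'a \<Rightarrow>\<^sub>L 'a"
    and x :: "nat \<Rightarrow> 'a"
    and p :: nat
  assumes "unital_subalgebra A"
    and "abelian A"
    and "semisimple A"
    and "closedin strong_operator_topology A"
    and "realizes_ssm A p x"
    and "L \<subseteq> A" and "csubspace L" and "closed L"
    and "T \<in> bounded_ops"
    and "\<And>y. blinfun_apply T y \<in> closure (orbit_of L y)"
  shows "\<exists>l\<^sub>0\<in>L. \<forall>y. blinfun_apply (T - l\<^sub>0) y \<in>
    split_map A p x ` (\<Pi>\<^sub>E j\<in>{1..p}. radical_of (quot_alg A (x j)))"
proof -
  \<comment> \<open>The strong operator topology is coarser than the norm topology.\<close>
  have "closed A"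
    using closedin_continuous_map_preimage[OF strong_operator_topology_weaker_than_euclidean assms(4)]
    by simp
  then interpret split_operator_algebra A p x
    using assms by unfold_locales
  have "closed (orbit_of L u)"
    using assms by (intro closed_orbit_u csubspace_imp_subspace)
  then have "blinfun_apply T u \<in> orbit_of L u"
    using assms(10)[of u] by simp
  then obtain l where l: "l \<in> L" "blinfun_apply T u = blinfun_apply l u"
    by (auto simp: orbit_of_def)
  have lA: "l \<in> A" using l(1) assms(6) by blast
  have "T - l \<in> bounded_ops"
    using assms(9) apply_scaleC[OF lA]
    by (auto simp: bounded_ops_def blinfun.diff_left scaleC_diff_right)
  moreover have "blinfun_apply (T - l) y \<in> closure (orbit_of A y)" for y
  proof -
    \<comment> \<open>Translation by \<open>- l y\<close> is continuous and maps the
      \<open>L\<close>-orbit of \<open>y\<close> into its \<open>A\<close>-orbit, since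
      \<open>l\<close> and \<open>L\<close> lie in \<open>A\<close>.\<close>
    have "(\<lambda>z. z - blinfun_apply l y) ` closure (orbit_of L y) \<subseteq> closure (orbit_of A y)"
    proof (rule image_closure_subset)
      have "k - l \<in> A" if "k \<in> L" for k
        using that assms(6) lA by (intro mem_intros) auto
      then have "(\<lambda>z. z - blinfun_apply l y) ` orbit_of L y \<subseteq> orbit_of A y"
        by (force simp: orbit_of_def simp flip: blinfun.diff_left)
      then show "(\<lambda>z. z - blinfun_apply l y) ` orbit_of L y \<subseteq> closure (orbit_of A y)"
        using closure_subset by blast
    qed (auto intro!: continuous_intros)
    then show ?thesis
      using assms(10)[of y] by (auto simp: blinfun.diff_left)
  qed
  moreover have "blinfun_apply (T - l) u = 0"
    using l(2) by (simp add: blinfun.diff_left)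
  ultimately show ?thesis
    using l(1) kills_u_imp_radical by blast
qed

end
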